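(* Let $\lambda:\mathbb N\to\mathbb N$ be any function with $\lambda(n)\to\infty$, let $\delta(n)\to0$ as $n\to\infty$, and let $\gamma>0$. If $\mathcal D$ is a $\lambda$-well-behaved (feasible) degree sequence of length $n$ with $R_{\mathcal D}\le\delta(n)M_{\mathcal D}$, then the probability that $H(\mathcal D)$ has a component of size at least $\gamma M_{\mathcal D}$ is $o(1)$ (as $n\to\infty$, uniformly in such $\mathcal D$).
   Context: A degree sequence $\mathcal D=(d_1,\dots,d_n)$ consists of positive integers (no zero entries) and is feasible if realizable by a simple graph; $G(\mathcal D)$ is a uniformly random simple graph on $\{1,\dots,n\}$ with vertex $i$ of degree $d_i$. With $\pi$ a permutation such that $d_{\pi_1}\le\dots\le d_{\pi_n}$, let $j_{\mathcal D}=\min\big(\{j\in[n]:\sum_{i=1}^j d_{\pi_i}(d_{\pi_i}-2)>0\}\cup\{n\}\big)$, $R_{\mathcal D}=\sum_{i=j_{\mathcal D}}^n d_{\pi_i}$, $M_{\mathcal D}=\sum_{i:d_i\ne2}d_i$; $\mathcal D$ is $\lambda$-well-behaved if $M_{\mathcal D}\ge\lambda(n)$. $H(\mathcal D)$ is the multigraph obtained from $G(\mathcal D)$ by deleting all components that are cycles and then suppressing every vertex of degree 2 (deleting it and joining its two neighbours by an edge, possibly creating loops and multiple edges). The size of a component is its number of edges. *)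

theory Defs
  imports "HOL-Probability.Probability" "HOL-Library.Uprod" "HOL-Combinatorics.Permutations"
begin

datatype 'a mgraph = MGraph (verts: "'a set") (edges: "'a uprod multiset")

text \<open>A loop \<open>Upair v v\<close> counts twice towards the degree of \<open>v\<close>.\<close>

definition mdegree :: "'a mgraph \<Rightarrow> 'a \<Rightarrow> nat" where
  "mdegree G v =
     (\<Sum>e\<in>#edges G. if e = Upair v v then 2 else if v \<in> set_uprod e then 1 else 0)"

definition simple_graph :: "'a mgraph \<Rightarrow> bool" where
  "simple_graph G \<longleftrightarrow>
     finite (verts G) \<and>
     (\<forall>e\<in>#edges G. set_uprod e \<subseteq> verts G \<and> proper_uprod e \<and> count (edges G) e = 1)"

definition adjacent :: "'a mgraph \<Rightarrow> 'a \<Rightarrow> 'a \<Rightarrow> bool" where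
  "adjacent G u v \<longleftrightarrow> Upair u v \<in># edges G"

definition induced_subgraph :: "'a mgraph \<Rightarrow> 'a set \<Rightarrow> 'a mgraph" where
  "induced_subgraph G U = MGraph U {#e \<in># edges G. set_uprod e \<subseteq> U#}"

definition graph_components :: "'a mgraph \<Rightarrow> 'a mgraph set" where
  "graph_components G =
     {induced_subgraph G {v \<in> verts G. (adjacent G)\<^sup>*\<^sup>* u v} | u. u \<in> verts G}"

definition is_cycle :: "'a mgraph \<Rightarrow> bool" where
  "is_cycle G \<longleftrightarrow>
     (\<exists>vs. distinct vs \<and> length vs \<ge> 3 \<and> verts G = set vs \<and>
        edges G = {#Upair (vs ! i) (vs ! (Suc i mod length vs)). i \<in># mset [0..<length vs]#})"

definition delete_cycle_components :: "'a mgraph \<Rightarrow> 'a mgraph" where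
  "delete_cycle_components G =
     induced_subgraph G (verts G - \<Union> (verts ` {C \<in> graph_components G. is_cycle C}))"

definition incident_edges :: "'a mgraph \<Rightarrow> 'a \<Rightarrow> 'a uprod multiset" where
  "incident_edges G v = {#e \<in># edges G. v \<in> set_uprod e#}"

text \<open>
  Only meant for a vertex \<open>v\<close> that carries no loop and has exactly two incident edges
  \<open>Upair v a\<close> and \<open>Upair v b\<close> (see \<open>suppress_eq\<close>). The case \<open>a = b\<close> of two
  parallel edges is allowed and creates a loop at \<open>a\<close>.
\<close>

definition suppress :: "'a \<Rightarrow> 'a mgraph \<Rightarrow> 'a mgraph" where
  "suppress v G =
     MGraph (verts G - {v})
       (edges G - incident_edges G v +
        {#THE e. \<exists>a b. incident_edges G v = {#Upair v a, Upair v b#} \<and> e = Upair a b#})"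

lemma suppress_eq:
  assumes "incident_edges G v = {#Upair v a, Upair v b#}"
  shows "suppress v G =
     MGraph (verts G - {v}) (edges G - {#Upair v a, Upair v b#} + {#Upair a b#})"
proof -
  have "(THE e. \<exists>c d. incident_edges G v = {#Upair v c, Upair v d#} \<and> e = Upair c d) = Upair a b"
  proof (rule the_equality)
    show "\<exists>c d. incident_edges G v = {#Upair v c, Upair v d#} \<and> Upair a b = Upair c d"
      using assms by blast
  next
    fix e
    assume "\<exists>c d. incident_edges G v = {#Upair v c, Upair v d#} \<and> e = Upair c d"
    then show "e = Upair a b"
      using assms by (auto simp: add_eq_conv_ex)
  qed
  then show ?thesis
    using assms by (simp add: suppress_def)
qed

text \<open>
  Suppressing a vertex keeps all other degrees, so the vertices to be suppressed can be read
  off the initial graph. Starting from a simple graph no component of which is a cycle,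
  \<open>suppress\<close> is only ever applied to a loopless vertex as in \<open>suppress_eq\<close>, and the
  order of the suppressions is irrelevant; increasing order is used to be definite.
\<close>

definition suppress_all :: "'a::linorder mgraph \<Rightarrow> 'a mgraph" where
  "suppress_all G = fold suppress (sorted_list_of_set {v \<in> verts G. mdegree G v = 2}) G"

definition reduced_graph :: "'a::linorder mgraph \<Rightarrow> 'a mgraph" where
  "reduced_graph G = suppress_all (delete_cycle_components G)"

text \<open>
  A degree sequence of length \<open>n\<close> is a function \<open>d\<close> of which only the values on \<open>{1..n}\<close>
  are relevant.
\<close>

definition realizations :: "nat \<Rightarrow> (nat \<Rightarrow> nat) \<Rightarrow> nat mgraph set" where
  "realizations n d =
     {G. simple_graph G \<and> verts G = {1..n} \<and> (\<forall>i\<in>{1..n}. mdegree G i = d i)}"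

definition feasible_sequence :: "nat \<Rightarrow> (nat \<Rightarrow> nat) \<Rightarrow> bool" where
  "feasible_sequence n d \<longleftrightarrow> (\<forall>i\<in>{1..n}. d i > 0) \<and> realizations n d \<noteq> {}"

lemma finite_realizations: "finite (realizations n d)"
proof (rule finite_subset)
  let ?P = "(\<lambda>(a, b). Upair a b) ` ({1..n} \<times> {1..n})"
  show "realizations n d \<subseteq> (\<lambda>E. MGraph {1..n} (mset_set E)) ` Pow ?P"
  proof
    fix G
    assume "G \<in> realizations n d"
    then have s: "simple_graph G" and v: "verts G = {1..n}"
      by (auto simp: realizations_def)
    have "edges G = mset_set (set_mset (edges G))"
      using s by (intro multiset_eqI) (auto simp: simple_graph_def count_mset_set' not_in_iff)
    then have "G = MGraph {1..n} (mset_set (set_mset (edges G)))"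
      using v by (cases G) simp
    moreover have "set_mset (edges G) \<subseteq> ?P"
    proof
      fix e
      assume "e \<in># edges G"
      then have "set_uprod e \<subseteq> {1..n}"
        using s v by (auto simp: simple_graph_def)
      then show "e \<in> ?P"
        by (cases e) force
    qed
    ultimately show "G \<in> (\<lambda>E. MGraph {1..n} (mset_set E)) ` Pow ?P"
      by blast
  qed
  show "finite ((\<lambda>E. MGraph {1..n} (mset_set E)) ` Pow ?P)"
    by (intro finite_imageI) simp
qed

definition random_graph :: "nat \<Rightarrow> (nat \<Rightarrow> nat) \<Rightarrow> nat mgraph pmf" where
  "random_graph n d = pmf_of_set (realizations n d)"

definition random_reduced_graph :: "nat \<Rightarrow> (nat \<Rightarrow> nat) \<Rightarrow> nat mgraph pmf" where
  "random_reduced_graph n d = map_pmf reduced_graph (random_graph n d)"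

definition sorting_permutation :: "nat \<Rightarrow> (nat \<Rightarrow> nat) \<Rightarrow> (nat \<Rightarrow> nat) \<Rightarrow> bool" where
  "sorting_permutation n d \<pi> \<longleftrightarrow>
     \<pi> permutes {1..n} \<and> (\<forall>i\<in>{1..n}. \<forall>k\<in>{1..n}. i \<le> k \<longrightarrow> d (\<pi> i) \<le> d (\<pi> k))"

definition j_seq :: "nat \<Rightarrow> (nat \<Rightarrow> nat) \<Rightarrow> (nat \<Rightarrow> nat) \<Rightarrow> nat" where
  "j_seq n d \<pi> =
     Min ({j \<in> {1..n}. (\<Sum>i=1..j. int (d (\<pi> i)) * (int (d (\<pi> i)) - 2)) > 0} \<union> {n})"

definition R_seq :: "nat \<Rightarrow> (nat \<Rightarrow> nat) \<Rightarrow> (nat \<Rightarrow> nat) \<Rightarrow> nat" where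
  "R_seq n d \<pi> = (\<Sum>i=j_seq n d \<pi>..n. d (\<pi> i))"

definition M_seq :: "nat \<Rightarrow> (nat \<Rightarrow> nat) \<Rightarrow> nat" where
  "M_seq n d = (\<Sum>i | i \<in> {1..n} \<and> d i \<noteq> 2. d i)"

definition well_behaved :: "(nat \<Rightarrow> nat) \<Rightarrow> nat \<Rightarrow> (nat \<Rightarrow> nat) \<Rightarrow> bool" where
  "well_behaved lam n d \<longleftrightarrow> M_seq n d \<ge> lam n"

end

theory Submission
  imports Defs
begin

text \<open>
  The uniform random graph is the projection of a uniform random pairing of labelled half-edges
  whose projection is simple. Matching the ends of every path through vertices of degree two
  turns it into a random pairing \<open>\<tau>\<close> of the \<open>M\<close> half-edges at the other vertices. Exchanging
  two of these half-edges \<open>k\<close> and \<open>y\<close>, i.e. conjugating with the transposition \<open>(k y)\<close>,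
  preserves simplicity for all but \<open>o(M)\<close> choices of \<open>y\<close>. So, as long as at most \<open>M / 8\<close>
  half-edges have been matched, the next partner is at most slightly more likely than uniform to
  be any given half-edge.

  Explore from the vertices of highest degree, which have degree sum \<open>R\<close>, and one more vertex
  \<open>v\<close>. The sum of \<open>d * (d - 2)\<close> over all other vertices is at most \<open>0\<close>, and if the exploration
  survives \<open>s\<close> steps then the part of this sum that belongs to vertices not yet reached has
  dropped by order \<open>s\<close>. So the expected number of unmatched half-edges at reached vertices
  changes in step \<open>s\<close> by at most \<open>o(1) - s / M\<close> on survival. As this number starts at
  \<open>O(R) = o(M)\<close> and stays nonnegative, the exploration survives \<open>\<gamma> * M / 2\<close> steps with
  probability \<open>o(1)\<close>. It does survive if \<open>v\<close> lies in a component of size \<open>\<gamma> * M\<close>. Such a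
  component has degree sum at least \<open>2 * \<gamma> * M\<close>, hence averaging over \<open>v\<close> with weight \<open>d v\<close>
  bounds the probability that it exists.
\<close>

section \<open>Exploring a random pairing\<close>

text \<open>The simple pairings may be a vanishing share of all pairings, so nothing carries over
  from a uniform pairing to a uniform simple one; every comparison is therefore made inside the
  simple pairings. Vertices of degree two may outnumber \<open>M\<close> by any factor, so progress
  has to be measured in the other half-edges alone. This is possible because conjugation by a
  transposition of two such half-edges commutes with splicing: one exchange changes the simple
  pairing and the spliced pairing in the same way. An upper bound on the probability of each partner
  suffices, since the number of half-edges that a partner opens up is never negative. Only
  expectations are compared and no concentration is used: over T steps the negative drift amounts to
  about T^2 / M for each pairing that survives, against a budget of o(M) for each pairing. With T of
  order \<gamma> * M the share of survivors is o(1) / \<gamma>^2, and the averaging over the start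
  vertex costs one more factor 1 / \<gamma>.\<close>

definition pairing :: "'x set \<Rightarrow> ('x \<Rightarrow> 'x) \<Rightarrow> bool" where
  "pairing X \<tau> \<longleftrightarrow> (\<forall>x\<in>X. \<tau> x \<in> X \<and> \<tau> x \<noteq> x \<and> \<tau> (\<tau> x) = x)"

lemma sum_over_fibres:
  fixes f :: "'v \<Rightarrow> 'a::comm_semiring_1"
  assumes "finite X"
  shows "(\<Sum>x\<in>X. f (vt x)) = (\<Sum>w\<in>vt ` X. of_nat (card {x \<in> X. vt x = w}) * f w)"
proof -
  have "(\<Sum>x\<in>X. f (vt x)) = (\<Sum>w\<in>vt ` X. \<Sum>x | x \<in> X \<and> vt x = w. f (vt x))"
    using assms by (rule sum.image_gen)
  also have "\<dots> = (\<Sum>w\<in>vt ` X. of_nat (card {x \<in> X. vt x = w}) * f w)"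
    by (intro sum.cong) auto
  finally show ?thesis .
qed

text \<open>
  \<open>exposed \<tau> s\<close> is the set of half-edges matched in the first \<open>s\<close> steps of exploring, from
  the vertices in \<open>S\<close>, the multigraph given by the pairing \<open>\<tau>\<close>. The half-edge to be matched
  next depends only on this set, so pairings that agree on it have the same history.
\<close>

locale exploration =
  fixes X :: "'x set" and vt :: "'x \<Rightarrow> 'v" and S :: "'v set"
  assumes finite_X: "finite X" and finite_S: "finite S"
begin

definition deg :: "'v \<Rightarrow> nat" where
  "deg w = card {x \<in> X. vt x = w}"

definition reached :: "'x set \<Rightarrow> 'v set" where
  "reached E = S \<union> vt ` E"

definition active :: "'x set \<Rightarrow> 'x set" where
  "active E = {x \<in> X. vt x \<in> reached E} - E"

definition pick :: "'x set \<Rightarrow> 'x" where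
  "pick E = (SOME x. x \<in> active E)"

primrec exposed :: "('x \<Rightarrow> 'x) \<Rightarrow> nat \<Rightarrow> 'x set" where
  "exposed \<tau> 0 = {}"
| "exposed \<tau> (Suc s) =
     (let E = exposed \<tau> s in if active E = {} then E else E \<union> {pick E, \<tau> (pick E)})"

definition alive :: "('x \<Rightarrow> 'x) \<Rightarrow> nat \<Rightarrow> bool" where
  "alive \<tau> s \<longleftrightarrow> active (exposed \<tau> s) \<noteq> {}"

definition partner :: "('x \<Rightarrow> 'x) \<Rightarrow> nat \<Rightarrow> 'x" where
  "partner \<tau> s = \<tau> (pick (exposed \<tau> s))"

definition free :: "('x \<Rightarrow> 'x) \<Rightarrow> nat \<Rightarrow> 'x set" where
  "free \<tau> s = X - exposed \<tau> s - {pick (exposed \<tau> s)}"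

text \<open>Reaching a new vertex through \<open>y\<close> opens its half-edges except
  \<open>y\<close> itself. A partner at a reached vertex opens none and even leaves the active set,
  but is counted as 0 rather than -1: this keeps \<open>gain\<close> nonnegative on
  \<open>X\<close>, which the one-sided estimate in \<open>gain_switching\<close> relies on.\<close>

definition gain :: "'x set \<Rightarrow> 'x \<Rightarrow> real" where
  "gain E y = (if vt y \<in> reached E then 0 else real (deg (vt y)) - 1)"

lemma exposed_Suc_alive:
  "alive \<tau> s \<Longrightarrow> exposed \<tau> (Suc s) = exposed \<tau> s \<union> {pick (exposed \<tau> s), partner \<tau> s}"
  by (simp add: alive_def Let_def partner_def)

lemma exposed_Suc_dead: "\<not> alive \<tau> s \<Longrightarrow> exposed \<tau> (Suc s) = exposed \<tau> s"
  by (simp add: alive_def Let_def)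

lemma pick_active: "alive \<tau> s \<Longrightarrow> pick (exposed \<tau> s) \<in> active (exposed \<tau> s)"
  unfolding alive_def pick_def by (meson ex_in_conv someI_ex)

lemma alive_Suc: "alive \<tau> (Suc s) \<Longrightarrow> alive \<tau> s"
  using exposed_Suc_dead alive_def by metis

lemma alive_mono: "alive \<tau> t \<Longrightarrow> s \<le> t \<Longrightarrow> alive \<tau> s"
  by (induction t) (auto simp: le_Suc_eq dest: alive_Suc)

lemma exposed_agree:
  assumes "\<And>x. x \<in> exposed \<tau> s \<Longrightarrow> \<tau>' x = \<tau> x"
  shows "exposed \<tau>' s = exposed \<tau> s"
  using assms
proof (induction s)
  case (Suc s)
  have eq: "exposed \<tau>' s = exposed \<tau> s"
    using Suc by (auto simp: Let_def)
  show ?case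
    using Suc.prems by (simp add: eq Let_def split: if_splits)
qed simp

section \<open>Deterministic estimates for the exploration of one pairing\<close>

context
  fixes \<tau> assumes \<tau>: "pairing X \<tau>"
begin

lemma pick_props:
  assumes "alive \<tau> s"
  shows "pick (exposed \<tau> s) \<in> X" "vt (pick (exposed \<tau> s)) \<in> reached (exposed \<tau> s)"
    "pick (exposed \<tau> s) \<notin> exposed \<tau> s"
  using pick_active[OF assms] by (auto simp: active_def)

lemma exposed_subset: "exposed \<tau> s \<subseteq> X"
proof (induction s)
  case (Suc s)
  show ?case
  proof (cases "alive \<tau> s")
    case True
    then show ?thesis
      using Suc \<tau> pick_props(1)[OF True]
      by (simp add: exposed_Suc_alive partner_def pairing_def del: exposed.simps)
  qed (use Suc in \<open>simp add: exposed_Suc_dead del: exposed.simps\<close>)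
qed simp

lemma finite_exposed: "finite (exposed \<tau> s)"
  using exposed_subset finite_X finite_subset by blast

lemma exposed_closed: "x \<in> exposed \<tau> s \<Longrightarrow> \<tau> x \<in> exposed \<tau> s"
proof (induction s)
  case (Suc s)
  show ?case
  proof (cases "alive \<tau> s")
    case True
    then show ?thesis
      using Suc \<tau> pick_props(1)[OF True]
      by (auto simp: exposed_Suc_alive partner_def pairing_def simp del: exposed.simps)
  qed (use Suc in \<open>simp add: exposed_Suc_dead del: exposed.simps\<close>)
qed simp

lemma partner_free:
  assumes "alive \<tau> s"
  shows "partner \<tau> s \<in> free \<tau> s"
proof -
  let ?h = "pick (exposed \<tau> s)"
  have "?h \<in> X" "?h \<notin> exposed \<tau> s"
    using pick_props[OF assms] by auto
  moreover have "\<tau> ?h \<notin> exposed \<tau> s"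
    using exposed_closed[of "\<tau> ?h" s] \<tau> calculation by (auto simp: pairing_def)
  ultimately show ?thesis
    using \<tau> by (auto simp: partner_def free_def pairing_def)
qed

lemma card_exposed: "alive \<tau> s \<Longrightarrow> card (exposed \<tau> s) = 2 * s"
proof (induction s)
  case (Suc s)
  have al: "alive \<tau> s"
    using Suc.prems by (rule alive_Suc)
  have "card (exposed \<tau> (Suc s)) = card (exposed \<tau> s) + 2"
    using partner_free[OF al] pick_props[OF al] finite_exposed
    by (auto simp: exposed_Suc_alive[OF al] free_def card_insert_if simp del: exposed.simps)
  then show ?case
    using Suc.IH[OF al] by simp
qed simp

lemma card_exposed_le: "card (exposed \<tau> s) \<le> 2 * s"
proof (induction s)
  case (Suc s)
  show ?case
  proof (cases "alive \<tau> s")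
    case True
    then have "card (exposed \<tau> (Suc s)) \<le> card (exposed \<tau> s) + card {pick (exposed \<tau> s), partner \<tau> s}"
      by (simp only: exposed_Suc_alive card_Un_le)
    also have "card {pick (exposed \<tau> s), partner \<tau> s} \<le> 2"
      by (simp add: card_insert_if)
    finally show ?thesis
      using Suc by simp
  qed (use Suc in \<open>simp add: exposed_Suc_dead del: exposed.simps\<close>)
qed simp

lemma card_free:
  assumes "alive \<tau> s"
  shows "real (card (free \<tau> s)) = real (card X) - 2 * real s - 1"
proof -
  have sub: "insert (pick (exposed \<tau> s)) (exposed \<tau> s) \<subseteq> X"
    using exposed_subset pick_props[OF assms] by auto
  have "free \<tau> s = X - insert (pick (exposed \<tau> s)) (exposed \<tau> s)"
    by (auto simp: free_def)
  then have "card (free \<tau> s) = card X - (2 * s + 1)"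
    using sub pick_props[OF assms] finite_exposed card_exposed[OF assms]
    by (simp add: card_Diff_subset)
  moreover have "2 * s + 1 \<le> card X"
    using card_mono[OF finite_X sub] pick_props[OF assms] finite_exposed card_exposed[OF assms]
    by simp
  ultimately show ?thesis
    by (simp add: of_nat_diff)
qed

text \<open>The picked half-edge lies at a reached vertex, so only its partner can add a vertex in a
  step.\<close>

lemma card_new_reached: "card (vt ` exposed \<tau> s - S) \<le> s"
proof (induction s)
  case (Suc s)
  show ?case
  proof (cases "alive \<tau> s")
    case True
    have "vt ` exposed \<tau> (Suc s) - S \<subseteq> insert (vt (partner \<tau> s)) (vt ` exposed \<tau> s - S)"
      using pick_props(2)[OF True]
      by (auto simp: exposed_Suc_alive[OF True] reached_def simp del: exposed.simps)
    then have "card (vt ` exposed \<tau> (Suc s) - S) \<le> card (insert (vt (partner \<tau> s)) (vt ` exposed \<tau> s - S))"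
      using finite_exposed by (intro card_mono) auto
    also have "\<dots> \<le> Suc (card (vt ` exposed \<tau> s - S))"
      using finite_exposed by (simp add: card_insert_if)
    finally show ?thesis
      using Suc by simp
  qed (use Suc in \<open>simp add: exposed_Suc_dead del: exposed.simps\<close>)
qed simp

text \<open>The -1 accounts for the picked half-edge. The bound is not sharp if the partner was
  active too, because then two half-edges leave the active set.\<close>

lemma card_active_Suc:
  assumes "alive \<tau> s"
  shows "real (card (active (exposed \<tau> (Suc s)))) \<le>
    real (card (active (exposed \<tau> s))) + (gain (exposed \<tau> s) (partner \<tau> s) - 1)"
proof -
  let ?E = "exposed \<tau> s" and ?k = "partner \<tau> s"
  let ?h = "pick ?E"
  have k: "?k \<in> X"
    using partner_free[OF assms] by (auto simp: free_def)
  have h: "?h \<in> active ?E" and vh: "vt ?h \<in> reached ?E"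
    using pick_active[OF assms] pick_props[OF assms] by auto
  have fin: "finite (active ?E)"
    using finite_X by (auto simp: active_def)
  have c: "real (card (active ?E - {?h})) = real (card (active ?E)) - 1"
  proof -
    have "card (active ?E) > 0"
      using h fin card_gt_0_iff by blast
    then show ?thesis
      using card_Diff_singleton[OF h] by simp
  qed
  have E': "exposed \<tau> (Suc s) = ?E \<union> {?h, ?k}"
    using assms by (rule exposed_Suc_alive)
  show ?thesis
  proof (cases "vt ?k \<in> reached ?E")
    case True
    have "active (?E \<union> {?h, ?k}) \<subseteq> active ?E - {?h}"
      using True vh by (auto simp: active_def reached_def)
    then have "card (active (?E \<union> {?h, ?k})) \<le> card (active ?E - {?h})"
      using fin by (intro card_mono) auto
    then show ?thesis
      using True c by (simp add: E' gain_def del: exposed.simps)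
  next
    case False
    let ?D = "{x \<in> X. vt x = vt ?k}"
    have "active (?E \<union> {?h, ?k}) \<subseteq> (active ?E - {?h}) \<union> (?D - {?k})"
      using vh by (auto simp: active_def reached_def)
    then have "card (active (?E \<union> {?h, ?k})) \<le> card ((active ?E - {?h}) \<union> (?D - {?k}))"
      using fin finite_X by (intro card_mono) auto
    also have "\<dots> \<le> card (active ?E - {?h}) + card (?D - {?k})"
      by (rule card_Un_le)
    finally have "card (active (?E \<union> {?h, ?k})) \<le> card (active ?E - {?h}) + card (?D - {?k})" .
    moreover have "real (card (?D - {?k})) = real (deg (vt ?k)) - 1"
    proof -
      have "?k \<in> ?D" "finite ?D"
        using k finite_X by auto
      then have "card (?D - {?k}) = deg (vt ?k) - 1" "0 < deg (vt ?k)"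
        unfolding deg_def by (auto simp: card_gt_0_iff)
      then show ?thesis
        by simp
    qed
    ultimately show ?thesis
      using False c by (simp add: E' gain_def del: exposed.simps)
  qed
qed

text \<open>
  An exploration that is alive after \<open>s\<close> steps has reached degree sum more than \<open>2 * s\<close> but
  at most \<open>s\<close> vertices outside \<open>S\<close>. As \<open>deg w * (deg w - 1) \<ge> 3 * (deg w - 1)\<close> unless
  \<open>deg w = 2\<close>, these carry a share of at least \<open>3 * s\<close>, up to the degree sum of \<open>S\<close>, of
  \<open>\<Sum>w. deg w * (deg w - 1)\<close>, which beats the \<open>2 * s\<close> half-edges used up.
\<close>

lemma sum_gain_le:
  assumes al: "alive \<tau> s"
    and no2: "\<And>w. deg w \<noteq> 2"
    and Tp: "Tp \<subseteq> S"
    and sub: "(\<Sum>w\<in>vt ` X - Tp. real (deg w) * (real (deg w) - 2)) \<le> 0"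
  shows "(\<Sum>y\<in>free \<tau> s. gain (exposed \<tau> s) y) \<le>
    real (card X) - 3 * real s - 3 + 3 * (\<Sum>w\<in>S. real (deg w))"
proof -
  let ?E = "exposed \<tau> s" and ?V = "vt ` X"
  let ?A = "reached ?E" and ?d = "\<lambda>w. real (deg w)"
  have finV: "finite ?V"
    using finite_X by simp
  have degsum: "(\<Sum>x\<in>{x \<in> X. vt x \<in> Z}. f (vt x)) = (\<Sum>w\<in>?V \<inter> Z. ?d w * f w)" for Z f
  proof -
    have "vt ` {x \<in> X. vt x \<in> Z} = ?V \<inter> Z"
      by auto
    moreover have "{x \<in> {x \<in> X. vt x \<in> Z}. vt x = w} = {x \<in> X. vt x = w}" if "w \<in> ?V \<inter> Z" for w
      using that by auto
    ultimately show ?thesis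
      using sum_over_fibres[of "{x \<in> X. vt x \<in> Z}" f vt] finite_X by (simp add: deg_def)
  qed
  have M: "(\<Sum>w\<in>?V. ?d w) = real (card X)"
    using degsum[of "\<lambda>_. 1" UNIV] by simp
  have "(\<Sum>y\<in>free \<tau> s. gain ?E y) = (\<Sum>y\<in>{x \<in> X. vt x \<in> - ?A}. ?d (vt y) - 1)"
  proof (rule sum.mono_neutral_cong_right)
    show "finite (free \<tau> s)"
      using finite_X by (simp add: free_def)
    show "{x \<in> X. vt x \<in> - ?A} \<subseteq> free \<tau> s"
      using pick_props[OF al] by (auto simp: free_def reached_def)
  qed (auto simp: gain_def free_def)
  also have "\<dots> = (\<Sum>w\<in>?V - ?A. ?d w * (?d w - 1))"
    using degsum[of "\<lambda>w. ?d w - 1" "- ?A"] by (simp add: Diff_eq)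
  finally have G: "(\<Sum>y\<in>free \<tau> s. gain ?E y) = (\<Sum>w\<in>?V - ?A. ?d w * (?d w - 1))" .
  have ge1: "?d w \<ge> 1" if "w \<in> ?V" for w
    using that finite_X by (force simp: deg_def Suc_le_eq card_gt_0_iff)
  \<comment> \<open>Since \<open>d * (d - 1) = d * (d - 2) + d\<close>, the assumption
    \<open>sub\<close> bounds the sum over all vertices outside \<open>Tp\<close> by
    \<open>card X\<close>. The set \<open>Tp\<close> is kept apart from \<open>S\<close> because
    removing a start vertex of degree 1 from the sum in \<open>sub\<close> would raise that
    sum.\<close>
  have "(\<Sum>w\<in>?V - ?A. ?d w * (?d w - 1)) + (\<Sum>w\<in>?V \<inter> ?A - Tp. ?d w * (?d w - 1)) =
      (\<Sum>w\<in>(?V - ?A) \<union> (?V \<inter> ?A - Tp). ?d w * (?d w - 1))"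
    using finV by (intro sum.union_disjoint[symmetric]) auto
  also have "(?V - ?A) \<union> (?V \<inter> ?A - Tp) = ?V - Tp"
    using Tp by (auto simp: reached_def)
  also have "(\<Sum>w\<in>?V - Tp. ?d w * (?d w - 1)) =
      (\<Sum>w\<in>?V - Tp. ?d w * (?d w - 2)) + (\<Sum>w\<in>?V - Tp. ?d w)"
    by (simp add: sum.distrib[symmetric] algebra_simps)
  also have "\<dots> \<le> (\<Sum>w\<in>?V - Tp. ?d w)"
    using sub by simp
  also have "\<dots> \<le> real (card X)"
    unfolding M[symmetric] using finV by (intro sum_mono2) auto
  finally have 1: "(\<Sum>w\<in>?V - ?A. ?d w * (?d w - 1)) + (\<Sum>w\<in>?V \<inter> ?A - Tp. ?d w * (?d w - 1))
      \<le> real (card X)" .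
  have "(\<Sum>w\<in>?V \<inter> ?A - S. 3 * (?d w - 1)) \<le> (\<Sum>w\<in>?V \<inter> ?A - S. ?d w * (?d w - 1))"
  proof (rule sum_mono)
    fix w
    assume w: "w \<in> ?V \<inter> ?A - S"
    then have "deg w = 1 \<or> deg w \<ge> 3"
      using ge1[of w] no2[of w] by auto
    then show "3 * (?d w - 1) \<le> ?d w * (?d w - 1)"
      by (elim disjE, simp) (rule mult_right_mono, auto)
  qed
  also have "\<dots> \<le> (\<Sum>w\<in>?V \<inter> ?A - Tp. ?d w * (?d w - 1))"
    using finV Tp ge1 by (intro sum_mono2) auto
  finally have 2: "3 * (\<Sum>w\<in>?V \<inter> ?A - S. ?d w) - 3 * real (card (?V \<inter> ?A - S)) \<le>
      (\<Sum>w\<in>?V \<inter> ?A - Tp. ?d w * (?d w - 1))"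
    by (simp add: sum_subtractf sum_distrib_left right_diff_distrib)
  have "?V \<inter> ?A - S = vt ` ?E - S"
    using exposed_subset by (auto simp: reached_def)
  then have 3: "card (?V \<inter> ?A - S) \<le> s"
    using card_new_reached by simp
  have "real (card (?E \<union> active ?E)) = real (card ?E) + real (card (active ?E))"
    using finite_exposed finite_X by (subst card_Un_disjoint) (auto simp: active_def)
  moreover have "card (active ?E) \<ge> 1"
    using al finite_X by (auto simp: alive_def Suc_le_eq card_gt_0_iff active_def)
  ultimately have "2 * real s + 1 \<le> real (card (?E \<union> active ?E))"
    using card_exposed[OF al] by simp
  also have "?E \<union> active ?E = {x \<in> X. vt x \<in> ?A}"
    using exposed_subset by (auto simp: active_def reached_def)
  also have "real (card {x \<in> X. vt x \<in> ?A}) = (\<Sum>w\<in>?V \<inter> ?A. ?d w)"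
    using degsum[of "\<lambda>_. 1" ?A] by simp
  also have "\<dots> \<le> (\<Sum>w\<in>(?V \<inter> ?A - S) \<union> S. ?d w)"
    using finV finite_S by (intro sum_mono2) auto
  also have "\<dots> = (\<Sum>w\<in>?V \<inter> ?A - S. ?d w) + (\<Sum>w\<in>S. ?d w)"
    using finV finite_S by (intro sum.union_disjoint) auto
  \<comment> \<open>With \<open>D\<close> the degree sum of \<open>S\<close>, the reached vertices
    outside \<open>S\<close> have degree sum at least \<open>2 * s + 1 - D\<close>, and there are at
    most \<open>s\<close> of them. So their share is at least
    \<open>3 * (2 * s + 1 - D) - 3 * s = 3 * s + 3 - 3 * D\<close>.\<close>
  finally show ?thesis
    using 1 2 3 unfolding G by simp
qed

end

text \<open>Once no half-edge is active, the exposed half-edges are exactly those at reached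
  vertices, and they are closed under the pairing. Thus an early death confines everything connected
  to \<open>S\<close> to a set of small degree sum, which a large component contradicts.\<close>

lemma reached_of_dead:
  assumes "pairing X \<tau>" "\<not> alive \<tau> s"
  shows "\<exists>A. S \<subseteq> A \<and> card {x \<in> X. vt x \<in> A} \<le> 2 * s \<and> (\<forall>x\<in>X. vt x \<in> A \<longrightarrow> vt (\<tau> x) \<in> A)"
proof (intro exI conjI ballI impI)
  let ?E = "exposed \<tau> s"
  have eq: "{x \<in> X. vt x \<in> reached ?E} = ?E"
    using assms exposed_subset[OF assms(1)] by (auto simp: alive_def active_def reached_def)
  show "S \<subseteq> reached ?E"
    by (auto simp: reached_def)
  show "card {x \<in> X. vt x \<in> reached ?E} \<le> 2 * s"
    unfolding eq using card_exposed_le[OF assms(1)] .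
  show "vt (\<tau> x) \<in> reached ?E" if "x \<in> X" "vt x \<in> reached ?E" for x
    using that eq exposed_closed[OF assms(1), of x s] by (auto simp: reached_def)
qed

end

text \<open>The sample points \<sigma> are kept apart from the explored pairings
  \<open>\<tau> \<sigma>\<close>: different simple pairings may have the same spliced pairing, and
  whether a switch leads out of \<Omega> depends on \<sigma> itself. \<open>B\<close> bounds the
  number of failing switches for a fixed \<sigma> and \<open>k\<close>.\<close>

locale switching = exploration X vt S
  for X :: "'x set" and vt :: "'x \<Rightarrow> 'v" and S :: "'v set" +
  fixes \<Omega> :: "'s set" and \<tau> :: "'s \<Rightarrow> 'x \<Rightarrow> 'x" and sw :: "'x \<Rightarrow> 'x \<Rightarrow> 's \<Rightarrow> 's" and B :: real
  assumes finite_\<Omega>: "finite \<Omega>"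
    and pairing: "\<sigma> \<in> \<Omega> \<Longrightarrow> pairing X (\<tau> \<sigma>)"
    and sw_sw: "sw y k (sw k y \<sigma>) = \<sigma>"
    and \<tau>_sw: "\<sigma> \<in> \<Omega> \<Longrightarrow> k \<in> X \<Longrightarrow> y \<in> X \<Longrightarrow>
      x \<in> X \<Longrightarrow> \<tau> (sw k y \<sigma>) x = Transposition.transpose k y (\<tau> \<sigma> (Transposition.transpose k y x))"
    and few_bad: "\<sigma> \<in> \<Omega> \<Longrightarrow> k \<in> X \<Longrightarrow> real (card {y \<in> X. sw k y \<sigma> \<notin> \<Omega>}) \<le> B"
begin

definition survivors :: "nat \<Rightarrow> 's set" where
  "survivors s = {\<sigma> \<in> \<Omega>. alive (\<tau> \<sigma>) s}"

lemma finite_survivors: "finite (survivors s)"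
  using finite_\<Omega> by (simp add: survivors_def)

text \<open>The exposed set is closed under the pairing and contains neither the partner nor
  \<open>y\<close>, so the transposition moves nothing that the first \<open>s\<close> steps look
  at. The pick is therefore the same, is itself not moved, and its partner is carried to
  \<open>y\<close>.\<close>

lemma switch_step:
  assumes \<sigma>: "\<sigma> \<in> survivors s" and y: "y \<in> free (\<tau> \<sigma>) s"
    and ok: "sw (partner (\<tau> \<sigma>) s) y \<sigma> \<in> \<Omega>"
  defines "\<sigma>' \<equiv> sw (partner (\<tau> \<sigma>) s) y \<sigma>"
  shows "exposed (\<tau> \<sigma>') s = exposed (\<tau> \<sigma>) s" "\<sigma>' \<in> survivors s" "partner (\<tau> \<sigma>') s = y"
proof -
  let ?E = "exposed (\<tau> \<sigma>) s" and ?k = "partner (\<tau> \<sigma>) s"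
  have \<sigma>\<Omega>: "\<sigma> \<in> \<Omega>" and al: "alive (\<tau> \<sigma>) s"
    using \<sigma> by (auto simp: survivors_def)
  note p = pairing[OF \<sigma>\<Omega>]
  have k: "?k \<in> free (\<tau> \<sigma>) s"
    using partner_free[OF p al] .
  have kX: "?k \<in> X" "y \<in> X"
    using k y by (auto simp: free_def)
  have "\<tau> \<sigma>' x = \<tau> \<sigma> x" if "x \<in> ?E" for x
  proof -
    have "x \<in> X" "x \<noteq> ?k" "x \<noteq> y" "\<tau> \<sigma> x \<noteq> ?k" "\<tau> \<sigma> x \<noteq> y"
      using that k y exposed_subset[OF p] exposed_closed[OF p that] by (auto simp: free_def)
    then show ?thesis
      using \<tau>_sw[OF \<sigma>\<Omega> kX] by (simp add: \<sigma>'_def)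
  qed
  then show E: "exposed (\<tau> \<sigma>') s = ?E"
    by (rule exposed_agree)
  then show "\<sigma>' \<in> survivors s"
    using ok al by (simp add: \<sigma>'_def survivors_def alive_def)
  have "pick ?E \<in> X" "pick ?E \<noteq> ?k" "pick ?E \<noteq> y"
    using k y pick_props[OF p al] by (auto simp: free_def)
  then have "\<tau> \<sigma>' (pick ?E) = Transposition.transpose ?k y ?k"
    unfolding \<sigma>'_def by (subst \<tau>_sw[OF \<sigma>\<Omega> kX]) (simp_all add: partner_def)
  then show "partner (\<tau> \<sigma>') s = y"
    by (simp add: E partner_def)
qed

text \<open>
  Switching \<open>y\<close> with the partner is an involution on the admissible pairs \<open>(\<sigma>, y)\<close> which
  exchanges \<open>y\<close> and the partner. So up to the few inadmissible pairs the partner is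
  distributed at most like a uniform element of \<open>free\<close>.
\<close>

lemma gain_switching:
  "(real (card X) - 2 * real s - 1 - B) *
      (\<Sum>\<sigma>\<in>survivors s. gain (exposed (\<tau> \<sigma>) s) (partner (\<tau> \<sigma>) s)) \<le>
    (\<Sum>\<sigma>\<in>survivors s. \<Sum>y\<in>free (\<tau> \<sigma>) s. gain (exposed (\<tau> \<sigma>) s) y)"
proof -
  let ?k = "\<lambda>\<sigma>. partner (\<tau> \<sigma>) s" and ?E = "\<lambda>\<sigma>. exposed (\<tau> \<sigma>) s"
  let ?ok = "\<lambda>\<sigma>. {y \<in> free (\<tau> \<sigma>) s. sw (?k \<sigma>) y \<sigma> \<in> \<Omega>}"
  let ?P = "SIGMA \<sigma>:survivors s. ?ok \<sigma>"
  have fin: "finite (free (\<tau> \<sigma>) s)" for \<sigma>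
    using finite_X by (simp add: free_def)
  have gain0: "gain E y \<ge> 0" if "y \<in> X" for E y
    using that finite_X by (force simp: gain_def deg_def Suc_le_eq card_gt_0_iff)
  have "(real (card X) - 2 * real s - 1 - B) * (\<Sum>\<sigma>\<in>survivors s. gain (?E \<sigma>) (?k \<sigma>)) \<le>
      (\<Sum>\<sigma>\<in>survivors s. \<Sum>y\<in>?ok \<sigma>. gain (?E \<sigma>) (?k \<sigma>))"
    unfolding sum_distrib_left
  proof (rule sum_mono)
    fix \<sigma>
    assume "\<sigma> \<in> survivors s"
    then have \<sigma>\<Omega>: "\<sigma> \<in> \<Omega>" and al: "alive (\<tau> \<sigma>) s"
      by (auto simp: survivors_def)
    have k: "?k \<sigma> \<in> X"
      using partner_free[OF pairing[OF \<sigma>\<Omega>] al] by (auto simp: free_def)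
    have "card (free (\<tau> \<sigma>) s) \<le> card (?ok \<sigma> \<union> {y \<in> X. sw (?k \<sigma>) y \<sigma> \<notin> \<Omega>})"
      using finite_X by (intro card_mono) (auto simp: free_def)
    also have "\<dots> \<le> card (?ok \<sigma>) + card {y \<in> X. sw (?k \<sigma>) y \<sigma> \<notin> \<Omega>}"
      by (rule card_Un_le)
    finally have "real (card X) - 2 * real s - 1 - B \<le> real (card (?ok \<sigma>))"
      using few_bad[OF \<sigma>\<Omega> k] card_free[OF pairing[OF \<sigma>\<Omega>] al] by simp
    then show "(real (card X) - 2 * real s - 1 - B) * gain (?E \<sigma>) (?k \<sigma>) \<le>
        (\<Sum>y\<in>?ok \<sigma>. gain (?E \<sigma>) (?k \<sigma>))"
      using gain0[OF k] by (simp add: mult_right_mono)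
  qed
  also have "\<dots> = (\<Sum>(\<sigma>, y)\<in>?P. gain (?E \<sigma>) (?k \<sigma>))"
    using finite_survivors fin by (intro sum.Sigma) auto
  also have "\<dots> = (\<Sum>(\<sigma>, y)\<in>?P. gain (?E \<sigma>) y)"
  proof (rule sum.reindex_bij_witness[where i = "\<lambda>(\<sigma>, y). (sw (?k \<sigma>) y \<sigma>, ?k \<sigma>)"
        and j = "\<lambda>(\<sigma>, y). (sw (?k \<sigma>) y \<sigma>, ?k \<sigma>)"], goal_cases)
    have *: "(case (case p of (\<sigma>, y) \<Rightarrow> (sw (?k \<sigma>) y \<sigma>, ?k \<sigma>)) of (\<sigma>, y) \<Rightarrow> (sw (?k \<sigma>) y \<sigma>, ?k \<sigma>)) = p"
      "(case p of (\<sigma>, y) \<Rightarrow> (sw (?k \<sigma>) y \<sigma>, ?k \<sigma>)) \<in> ?P" if pP: "p \<in> ?P" for p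
    proof -
      obtain \<sigma> y where p: "p = (\<sigma>, y)" "\<sigma> \<in> survivors s" "y \<in> free (\<tau> \<sigma>) s" "sw (?k \<sigma>) y \<sigma> \<in> \<Omega>"
        using pP by (cases p) auto
      have \<sigma>\<Omega>: "\<sigma> \<in> \<Omega>" and al: "alive (\<tau> \<sigma>) s"
        using p by (auto simp: survivors_def)
      note st = switch_step[OF p(2-4)]
      have k: "?k \<sigma> \<in> free (\<tau> \<sigma>) s"
        using partner_free[OF pairing[OF \<sigma>\<Omega>] al] .
      show "(case (case p of (\<sigma>, y) \<Rightarrow> (sw (?k \<sigma>) y \<sigma>, ?k \<sigma>)) of (\<sigma>, y) \<Rightarrow> (sw (?k \<sigma>) y \<sigma>, ?k \<sigma>)) = p"
        using st by (simp add: p sw_sw)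
      show "(case p of (\<sigma>, y) \<Rightarrow> (sw (?k \<sigma>) y \<sigma>, ?k \<sigma>)) \<in> ?P"
        using st k \<sigma>\<Omega> by (simp add: p sw_sw) (simp add: free_def)
    qed
    {
      case 1 then show ?case by (rule *)
    next
      case 2 then show ?case by (rule *)
    next
      case 3 then show ?case by (rule *)
    next
      case 4 then show ?case by (rule *)
    next
      case (5 p) then show ?case using switch_step by auto
    }
  qed
  also have "\<dots> = (\<Sum>\<sigma>\<in>survivors s. \<Sum>y\<in>?ok \<sigma>. gain (?E \<sigma>) y)"
    using finite_survivors fin by (intro sum.Sigma[symmetric]) auto
  \<comment> \<open>Putting the inadmissible \<open>y\<close> back can only increase the sum, as
    \<open>gain\<close> is nonnegative.\<close>
  also have "\<dots> \<le> (\<Sum>\<sigma>\<in>survivors s. \<Sum>y\<in>free (\<tau> \<sigma>) s. gain (?E \<sigma>) y)"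
    using fin gain0 by (intro sum_mono sum_mono2) (auto simp: free_def)
  finally show ?thesis .
qed

text \<open>With \<open>U = card X - 2 * s - 1 - B\<close>, the lemmas \<open>gain_switching\<close>
  and \<open>sum_gain_le\<close> bound the drift per survivor by
  \<open>(3 * D + B - s - 2) / U\<close>. As \<open>U\<close> lies between \<open>card X / 2\<close>
  and \<open>card X\<close>, the positive terms are divided by the smaller and the negative term
  \<open>s\<close> by the larger of these two bounds.\<close>

lemma sum_active_Suc:
  assumes no2: "\<And>w. deg w \<noteq> 2"
    and Tp: "Tp \<subseteq> S"
    and sub: "(\<Sum>w\<in>vt ` X - Tp. real (deg w) * (real (deg w) - 2)) \<le> 0"
    and B: "B \<ge> 0" and s: "2 * real s + 1 + B \<le> real (card X) / 2"
  defines "D \<equiv> \<Sum>w\<in>S. real (deg w)"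
  shows "(\<Sum>\<sigma>\<in>\<Omega>. real (card (active (exposed (\<tau> \<sigma>) (Suc s))))) \<le>
    (\<Sum>\<sigma>\<in>\<Omega>. real (card (active (exposed (\<tau> \<sigma>) s)))) +
    real (card (survivors s)) * ((2 * (3 * D + B) - real s) / real (card X))"
proof -
  let ?Y = "\<lambda>s \<sigma>. real (card (active (exposed (\<tau> \<sigma>) s)))"
  let ?g = "\<lambda>\<sigma>. gain (exposed (\<tau> \<sigma>) s) (partner (\<tau> \<sigma>) s)"
  let ?M = "real (card X)" and ?n = "real (card (survivors s))"
  define U where "U = ?M - 2 * real s - 1 - B"
  have M: "?M > 0"
    using s B by simp
  have U: "U \<ge> ?M / 2" "U > 0" "U \<le> ?M"
    using s B M by (auto simp: U_def)
  have D: "D \<ge> 0"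
    by (simp add: D_def sum_nonneg)
  have "(\<Sum>\<sigma>\<in>\<Omega>. ?Y (Suc s) \<sigma> - ?Y s \<sigma>) = (\<Sum>\<sigma>\<in>survivors s. ?Y (Suc s) \<sigma> - ?Y s \<sigma>)"
    using finite_\<Omega> exposed_Suc_dead
    by (intro sum.mono_neutral_right) (auto simp: survivors_def simp del: exposed.simps)
  also have "\<dots> \<le> (\<Sum>\<sigma>\<in>survivors s. ?g \<sigma> - 1)"
  proof (rule sum_mono)
    fix \<sigma>
    assume "\<sigma> \<in> survivors s"
    then show "?Y (Suc s) \<sigma> - ?Y s \<sigma> \<le> ?g \<sigma> - 1"
      using card_active_Suc[OF pairing, of \<sigma> s] by (auto simp: survivors_def simp del: exposed.simps)
  qed
  also have "\<dots> = (\<Sum>\<sigma>\<in>survivors s. ?g \<sigma>) - ?n"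
    by (simp add: sum_subtractf)
  also have "\<dots> \<le> ?n * ((2 * (3 * D + B) - real s) / ?M)"
  proof -
    have "U * (\<Sum>\<sigma>\<in>survivors s. ?g \<sigma>) \<le>
        (\<Sum>\<sigma>\<in>survivors s. \<Sum>y\<in>free (\<tau> \<sigma>) s. gain (exposed (\<tau> \<sigma>) s) y)"
      unfolding U_def by (rule gain_switching)
    also have "\<dots> \<le> (\<Sum>\<sigma>\<in>survivors s. ?M - 3 * real s - 3 + 3 * D)"
    proof (rule sum_mono)
      fix \<sigma>
      assume "\<sigma> \<in> survivors s"
      then show "(\<Sum>y\<in>free (\<tau> \<sigma>) s. gain (exposed (\<tau> \<sigma>) s) y) \<le> ?M - 3 * real s - 3 + 3 * D"
        unfolding D_def using no2 Tp sub
        by (intro sum_gain_le[OF pairing]) (auto simp: survivors_def)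
    qed
    also have "\<dots> = ?n * (?M - 3 * real s - 3 + 3 * D)"
      by simp
    finally have "U * (\<Sum>\<sigma>\<in>survivors s. ?g \<sigma>) - U * ?n \<le> ?n * (3 * D + B - real s - 2)"
      by (simp add: U_def algebra_simps)
    also have "\<dots> \<le> ?n * (U * ((2 * (3 * D + B) - real s) / ?M))"
    proof (rule mult_left_mono)
      have "(3 * D + B) \<le> U * (2 * (3 * D + B) / ?M)"
      proof -
        have "?M / 2 * (2 * (3 * D + B) / ?M) = 3 * D + B"
          using M by simp
        then show ?thesis
          using mult_right_mono[OF U(1), of "2 * (3 * D + B) / ?M"] D B by auto
      qed
      moreover have "U * (real s / ?M) \<le> real s"
        using mult_right_mono[OF U(3), of "real s / ?M"] M by simp
      ultimately show "3 * D + B - real s - 2 \<le> U * ((2 * (3 * D + B) - real s) / ?M)"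
        by (simp add: diff_divide_distrib right_diff_distrib)
    qed simp
    finally have "U * ((\<Sum>\<sigma>\<in>survivors s. ?g \<sigma>) - ?n) \<le> U * (?n * ((2 * (3 * D + B) - real s) / ?M))"
      by (simp add: algebra_simps)
    then show ?thesis
      using U(2) by (rule mult_left_le_imp_le)
  qed
  finally show ?thesis
    by (simp add: sum_subtractf)
qed

text \<open>The steps are added up. Positive drift is charged to all of \<Omega>, negative drift
  only to \<open>survivors T\<close>, whose members survive every earlier step; the terms
  \<open>s\<close> then sum to \<open>T * (T - 1) / 2\<close>. The total of active half-edges starts
  at most at \<open>card \<Omega> * D\<close> and stays nonnegative. In \<open>4 * D\<close>, one
  \<open>D\<close> is this start and \<open>3 * D\<close> comes from the drift, by
  \<open>2 * T <= card X\<close>.\<close>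

lemma card_survivors_le:
  assumes no2: "\<And>w. deg w \<noteq> 2"
    and Tp: "Tp \<subseteq> S"
    and sub: "(\<Sum>w\<in>vt ` X - Tp. real (deg w) * (real (deg w) - 2)) \<le> 0"
    and B: "B \<ge> 0" and T: "2 * real T + 1 + B \<le> real (card X) / 2"
  defines "D \<equiv> \<Sum>w\<in>S. real (deg w)"
  shows "real (card (survivors T)) * (real T * (real T - 1)) \<le>
    2 * real (card X) * (4 * D + B) * real (card \<Omega>)"
proof -
  let ?Y = "\<lambda>s. \<Sum>\<sigma>\<in>\<Omega>. real (card (active (exposed (\<tau> \<sigma>) s)))"
  let ?M = "real (card X)" and ?p = "real (card (survivors T))" and ?N = "real (card \<Omega>)"
  have M: "?M > 0"
    using T B by simp
  have D: "D \<ge> 0"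
    by (simp add: D_def sum_nonneg)
  have Y0: "?Y 0 \<le> ?N * D"
  proof -
    have "real (card (active {})) \<le> D"
    proof -
      have "card (active {}) \<le> card (\<Union>w\<in>S. {x \<in> X. vt x = w})"
        using finite_S finite_X by (intro card_mono) (auto simp: active_def reached_def)
      also have "\<dots> \<le> (\<Sum>w\<in>S. deg w)"
        unfolding deg_def using finite_S by (rule card_UN_le)
      finally show ?thesis
        unfolding D_def by (metis of_nat_le_iff of_nat_sum)
    qed
    then show ?thesis
      by (simp add: mult_left_mono)
  qed
  have p: "?p \<le> real (card (survivors s))" if "s \<le> T" for s
    using that finite_survivors alive_mono by (auto intro!: card_mono simp: survivors_def)
  have n: "real (card (survivors s)) \<le> ?N" for s
    using finite_\<Omega> by (auto intro!: card_mono simp: survivors_def)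
  have step: "?Y (Suc s) \<le> ?Y s + ?N * (2 * (3 * D + B) / ?M) - ?p * (real s / ?M)" if "s < T" for s
  proof -
    have "?Y (Suc s) \<le> ?Y s + real (card (survivors s)) * ((2 * (3 * D + B) - real s) / ?M)"
      unfolding D_def using T that by (intro sum_active_Suc[OF no2 Tp sub B]) auto
    moreover have "real (card (survivors s)) * (2 * (3 * D + B) / ?M) \<le> ?N * (2 * (3 * D + B) / ?M)"
      using n D B M by (intro mult_right_mono) auto
    moreover have "?p * (real s / ?M) \<le> real (card (survivors s)) * (real s / ?M)"
      using p that by (intro mult_right_mono) auto
    ultimately show ?thesis
      by (simp add: diff_divide_distrib right_diff_distrib)
  qed
  have "?Y s \<le> ?Y 0 + real s * (?N * (2 * (3 * D + B) / ?M)) - ?p * (real s * (real s - 1) / (2 * ?M))"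
    if "s \<le> T" for s
    using that
  proof (induction s)
    case (Suc s)
    have "?Y (Suc s) \<le> ?Y 0 + real s * (?N * (2 * (3 * D + B) / ?M)) -
        ?p * (real s * (real s - 1) / (2 * ?M)) + ?N * (2 * (3 * D + B) / ?M) - ?p * (real s / ?M)"
      using Suc step[of s] by linarith
    also have "\<dots> = ?Y 0 + real (Suc s) * (?N * (2 * (3 * D + B) / ?M)) -
        ?p * (real (Suc s) * (real (Suc s) - 1) / (2 * ?M))"
      using M by (simp add: field_simps)
    finally show ?case .
  qed simp
  from this[of T] have "0 \<le> ?N * D + real T * (?N * (2 * (3 * D + B) / ?M)) -
      ?p * (real T * (real T - 1) / (2 * ?M))"
    using Y0 sum_nonneg[of \<Omega> "\<lambda>\<sigma>. real (card (active (exposed (\<tau> \<sigma>) T)))"] by simp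
  then have "2 * ?M * (?p * (real T * (real T - 1) / (2 * ?M))) \<le>
      2 * ?M * (?N * D + real T * (?N * (2 * (3 * D + B) / ?M)))"
    using M by (intro mult_left_mono) auto
  also have "2 * ?M * (?p * (real T * (real T - 1) / (2 * ?M))) = ?p * (real T * (real T - 1))"
    using M by simp
  also have "2 * ?M * (?N * D + real T * (?N * (2 * (3 * D + B) / ?M))) =
      2 * ?M * ?N * D + (2 * real T) * (2 * ?N * (3 * D + B))"
    using M by (simp add: field_simps)
  also have "(2 * real T) * (2 * ?N * (3 * D + B)) \<le> ?M * (2 * ?N * (3 * D + B))"
    using T B D by (intro mult_right_mono) auto
  finally show ?thesis
    by (simp add: algebra_simps)
qed

end

section \<open>Splicing out vertices of degree two\<close>

text \<open>For the two half-edges \<open>a\<close> and \<open>b\<close> of one vertex this is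
  suppression of that vertex: their mates become matched with each other. Values at \<open>a\<close>
  and \<open>b\<close> are of no interest. If \<open>a\<close> and \<open>b\<close> are matched with
  each other, nothing changes elsewhere and a closed cycle disappears.\<close>

definition splice :: "'x \<Rightarrow> 'x \<Rightarrow> ('x \<Rightarrow> 'x) \<Rightarrow> 'x \<Rightarrow> 'x" where
  "splice a b \<sigma> x = (if \<sigma> x = a then \<sigma> b else if \<sigma> x = b then \<sigma> a else \<sigma> x)"

text \<open>
  Every \<open>z\<close> in \<open>zs\<close> is meant to have exactly the half-edges \<open>(z, 0)\<close> and \<open>(z, 1)\<close>; the ends of
  every maximal path through such vertices are matched with each other.
\<close>

definition splice_all :: "'v list \<Rightarrow> ('v \<times> nat \<Rightarrow> 'v \<times> nat) \<Rightarrow> 'v \<times> nat \<Rightarrow> 'v \<times> nat" where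
  "splice_all zs = fold (\<lambda>z. splice (z, 0) (z, 1)) zs"

lemma pairing_splice:
  assumes "pairing X \<sigma>" "a \<in> X" "b \<in> X" "a \<noteq> b"
  shows "pairing (X - {a, b}) (splice a b \<sigma>)"
  unfolding pairing_def
proof
  fix x
  assume x: "x \<in> X - {a, b}"
  have p: "\<sigma> y \<in> X" "\<sigma> y \<noteq> y" "\<sigma> (\<sigma> y) = y" if "y \<in> X" for y
    using assms(1) that by (auto simp: pairing_def)
  have ab: "\<sigma> a \<in> X" "\<sigma> b \<in> X" "\<sigma> a \<noteq> a" "\<sigma> b \<noteq> b" "\<sigma> (\<sigma> a) = a" "\<sigma> (\<sigma> b) = b"
    and px: "x \<in> X" "x \<noteq> a" "x \<noteq> b" "\<sigma> x \<in> X" "\<sigma> x \<noteq> x" "\<sigma> (\<sigma> x) = x"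
    using p[OF assms(2)] p[OF assms(3)] p[of x] x by simp_all
  consider (a) "\<sigma> x = a" | (b) "\<sigma> x \<noteq> a" "\<sigma> x = b" | (c) "\<sigma> x \<noteq> a" "\<sigma> x \<noteq> b" by blast
  then show "splice a b \<sigma> x \<in> X - {a, b} \<and> splice a b \<sigma> x \<noteq> x \<and>
      splice a b \<sigma> (splice a b \<sigma> x) = x"
  proof cases
    case a
    then have \<tau>: "splice a b \<sigma> x = \<sigma> b"
      by (simp add: splice_def)
    have "\<sigma> a = x" "\<sigma> b \<noteq> a" "\<sigma> b \<noteq> x"
      using ab px a assms(4) by metis+
    then show ?thesis
      unfolding \<tau> using ab assms(4) by (simp add: splice_def)
  next
    case b
    then have \<tau>: "splice a b \<sigma> x = \<sigma> a"
      by (simp add: splice_def)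
    have "\<sigma> b = x" "\<sigma> a \<noteq> b" "\<sigma> a \<noteq> x"
      using ab px b assms(4) by metis+
    then show ?thesis
      unfolding \<tau> using ab assms(4) by (simp add: splice_def)
  next
    case c
    then show ?thesis
      using px by (simp add: splice_def)
  qed
qed

text \<open>An injective \<open>t\<close> that fixes \<open>a\<close> and \<open>b\<close> does not
  affect the tests in \<open>splice\<close>. Conjugation is written with \<open>t\<close> on both
  sides because it is applied to transpositions, which are their own inverses.\<close>

lemma splice_conj:
  assumes "inj t" "t a = a" "t b = b"
  shows "splice a b (t \<circ> \<sigma> \<circ> t) = t \<circ> splice a b \<sigma> \<circ> t"
proof
  fix x
  have t: "t y = a \<longleftrightarrow> y = a" "t y = b \<longleftrightarrow> y = b" for y
    using inj_eq[OF assms(1), of y a] inj_eq[OF assms(1), of y b] assms(2,3) by simp_all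
  show "splice a b (t \<circ> \<sigma> \<circ> t) x = (t \<circ> splice a b \<sigma> \<circ> t) x"
    unfolding splice_def o_apply t assms(2,3) by simp
qed

lemma splice_all_Cons: "splice_all (z # zs) \<sigma> = splice_all zs (splice (z, 0) (z, 1) \<sigma>)"
  by (simp add: splice_all_def)

lemma splice_all_conj:
  assumes "inj t" "\<And>z. z \<in> set zs \<Longrightarrow> t (z, 0) = (z, 0) \<and> t (z, 1) = (z, 1)"
  shows "splice_all zs (t \<circ> \<sigma> \<circ> t) = t \<circ> splice_all zs \<sigma> \<circ> t"
  using assms(2)
proof (induction zs arbitrary: \<sigma>)
  case (Cons z zs)
  have "splice (z, 0) (z, 1) (t \<circ> \<sigma> \<circ> t) = t \<circ> splice (z, 0) (z, 1) \<sigma> \<circ> t"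
    using Cons.prems assms(1) by (intro splice_conj) auto
  moreover have "splice_all zs (t \<circ> splice (z, 0) (z, 1) \<sigma> \<circ> t) =
      t \<circ> splice_all zs (splice (z, 0) (z, 1) \<sigma>) \<circ> t"
    by (rule Cons.IH, rule Cons.prems, simp)
  ultimately show ?case
    by (simp only: splice_all_Cons)
qed (simp add: splice_all_def)

lemma pairing_splice_all:
  assumes "pairing X \<sigma>" "distinct zs"
    and "\<And>z. z \<in> set zs \<Longrightarrow> {x \<in> X. fst x = z} = {(z, 0), (z, 1)}"
  shows "pairing {x \<in> X. fst x \<notin> set zs} (splice_all zs \<sigma>)"
  using assms
proof (induction zs arbitrary: X \<sigma>)
  case (Cons z zs)
  let ?X = "X - {(z, 0), (z, 1)}"
  have z: "{x \<in> X. fst x = z} = {(z, 0), (z, 1)}"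
    by (rule Cons.prems(3)) simp
  then have ab: "(z, 0) \<in> X" "(z, 1) \<in> X"
    by blast+
  have zX: "x = (z, 0) \<or> x = (z, 1) \<longleftrightarrow> fst x = z" if "x \<in> X" for x
    using z that by blast+
  have "pairing ?X (splice (z, 0) (z, 1) \<sigma>)"
    using Cons.prems(1) ab by (rule pairing_splice) simp
  then have "pairing {x \<in> ?X. fst x \<notin> set zs} (splice_all zs (splice (z, 0) (z, 1) \<sigma>))"
  proof (rule Cons.IH)
    show "{x \<in> ?X. fst x = w} = {(w, 0), (w, 1)}" if w: "w \<in> set zs" for w
    proof -
      have "{x \<in> ?X. fst x = w} = {x \<in> X. fst x = w}"
        using Cons.prems(2) w by force
      then show ?thesis
        using Cons.prems(3)[of w] w by simp
    qed
  qed (use Cons.prems(2) in simp)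
  moreover have "{x \<in> ?X. fst x \<notin> set zs} = {x \<in> X. fst x \<notin> set (z # zs)}"
    unfolding list.set using zX by blast
  ultimately show ?case
    by (simp add: splice_all_Cons)
qed (simp add: splice_all_def)

text \<open>Splicing matches the mates of the two half-edges at \<open>z\<close>, so a set closed
  for the spliced pairing contains the vertices of both mates or of neither (\<open>z\<close>
  aside). In the first case \<open>z\<close> is added to the set, in the second it is
  removed.\<close>

lemma closed_splice:
  fixes X :: "('v \<times> nat) set"
  assumes "pairing X \<sigma>" "{x \<in> X. fst x = z} = {(z, 0), (z, 1)}"
    and cl: "\<forall>x\<in>X - {(z, 0), (z, 1)}. fst x \<in> A \<longrightarrow> fst (splice (z, 0) (z, 1) \<sigma> x) \<in> A"
  shows "\<exists>A'. A' - {z} = A - {z} \<and> (\<forall>x\<in>X. fst x \<in> A' \<longrightarrow> fst (\<sigma> x) \<in> A')"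
proof -
  let ?a = "(z, 0::nat)" and ?b = "(z, 1::nat)" and ?A = "A - {z}"
  let ?\<tau> = "splice ?a ?b \<sigma>"
  have ab: "?a \<in> X" "?b \<in> X"
    using assms(2) by auto
  have z: "x = ?a \<or> x = ?b" if "x \<in> X" "fst x = z" for x
    using assms(2) that by blast
  have p: "\<sigma> y \<in> X" "\<sigma> y \<noteq> y" "\<sigma> (\<sigma> y) = y" if "y \<in> X" for y
    using assms(1) that by (auto simp: pairing_def)
  have cl': "fst (?\<tau> x) \<in> ?A" if "x \<in> X" "fst x \<in> ?A" for x
  proof -
    have x: "x \<in> X - {?a, ?b}"
      using that by auto
    then have "?\<tau> x \<in> X - {?a, ?b}"
      using pairing_splice[OF assms(1) ab] by (auto simp: pairing_def)
    then have "fst (?\<tau> x) \<noteq> z"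
      using z by blast
    then show ?thesis
      using cl x that by auto
  qed
  have A: "fst (\<sigma> x) \<in> ?A \<or> fst (\<sigma> x) = z" if "x \<in> X" "fst x \<in> ?A" for x
    using cl'[OF that] by (auto simp: splice_def split: if_splits)
  show ?thesis
  proof (cases "fst (\<sigma> ?a) \<in> ?A \<or> fst (\<sigma> ?b) \<in> ?A")
    case True
    have both: "fst (\<sigma> ?a) \<in> ?A \<and> fst (\<sigma> ?b) \<in> ?A"
      using True
    proof
      assume a: "fst (\<sigma> ?a) \<in> ?A"
      then show ?thesis
        using cl'[of "\<sigma> ?a"] p[OF ab(1)] by (simp add: splice_def)
    next
      assume b: "fst (\<sigma> ?b) \<in> ?A"
      then show ?thesis
        using cl'[of "\<sigma> ?b"] p[OF ab(2)] by (simp add: splice_def)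
    qed
    have "fst (\<sigma> x) \<in> insert z ?A" if "x \<in> X" "fst x \<in> insert z ?A" for x
    proof (cases "fst x = z")
      case True
      then show ?thesis
        using z[OF that(1)] both by auto
    next
      case False
      then show ?thesis
        using that A[of x] by auto
    qed
    then show ?thesis
      by (intro exI[of _ "insert z ?A"]) auto
  next
    case False
    have "fst (\<sigma> x) \<in> ?A" if "x \<in> X" "fst x \<in> ?A" for x
    proof -
      have "\<sigma> x \<noteq> ?a" "\<sigma> x \<noteq> ?b"
        using False that p(3)[of x] by metis+
      then show ?thesis
        using A[OF that] z[OF p(1)[OF that(1)]] by blast
    qed
    then show ?thesis
      by (intro exI[of _ ?A]) auto
  qed
qed

lemma closed_splice_all:
  assumes "pairing X \<sigma>" "distinct zs"
    and "\<And>z. z \<in> set zs \<Longrightarrow> {x \<in> X. fst x = z} = {(z, 0), (z, 1)}"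
    and "\<forall>x\<in>X. fst x \<notin> set zs \<longrightarrow> fst x \<in> A \<longrightarrow> fst (splice_all zs \<sigma> x) \<in> A"
  shows "\<exists>A'. A' - set zs = A - set zs \<and> (\<forall>x\<in>X. fst x \<in> A' \<longrightarrow> fst (\<sigma> x) \<in> A')"
  using assms
proof (induction zs arbitrary: X \<sigma>)
  case Nil
  then show ?case
    by (intro exI[of _ A]) (simp add: splice_all_def)
next
  case (Cons z zs)
  let ?X = "X - {(z, 0), (z, 1)}" and ?\<tau> = "splice (z, 0) (z, 1) \<sigma>"
  have z: "{x \<in> X. fst x = z} = {(z, 0), (z, 1)}"
    by (rule Cons.prems(3)) simp
  then have ab: "(z, 0) \<in> X" "(z, 1) \<in> X"
    by blast+
  have zX: "x = (z, 0) \<or> x = (z, 1) \<longleftrightarrow> fst x = z" if "x \<in> X" for x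
    using z that by blast
  have "\<exists>A'. A' - set zs = A - set zs \<and> (\<forall>x\<in>?X. fst x \<in> A' \<longrightarrow> fst (?\<tau> x) \<in> A')"
  proof (rule Cons.IH)
    show "pairing ?X ?\<tau>"
      using Cons.prems(1) ab by (rule pairing_splice) simp
    show "{x \<in> ?X. fst x = w} = {(w, 0), (w, 1)}" if w: "w \<in> set zs" for w
    proof -
      have "{x \<in> ?X. fst x = w} = {x \<in> X. fst x = w}"
        using Cons.prems(2) w by force
      then show ?thesis
        using Cons.prems(3)[of w] w by simp
    qed
    show "\<forall>x\<in>?X. fst x \<notin> set zs \<longrightarrow> fst x \<in> A \<longrightarrow> fst (splice_all zs ?\<tau> x) \<in> A"
    proof (intro ballI impI)
      fix x
      assume x: "x \<in> ?X" "fst x \<notin> set zs" "fst x \<in> A"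
      then have "fst x \<noteq> z"
        using zX by blast
      then show "fst (splice_all zs ?\<tau> x) \<in> A"
        using Cons.prems(4) x by (simp add: splice_all_Cons)
    qed
  qed (use Cons.prems(2) in simp)
  then obtain A1 where A1: "A1 - set zs = A - set zs"
    "\<forall>x\<in>?X. fst x \<in> A1 \<longrightarrow> fst (?\<tau> x) \<in> A1"
    by blast
  obtain A' where A': "A' - {z} = A1 - {z}" "\<forall>x\<in>X. fst x \<in> A' \<longrightarrow> fst (\<sigma> x) \<in> A'"
    using closed_splice[OF Cons.prems(1) z A1(2)] by blast
  have "A' - set (z # zs) = A - set (z # zs)"
    using A1(1) A'(1) by fastforce
  then show ?case
    using A'(2) by blast
qed

section \<open>Components of the reduced graph\<close>

definition incidence :: "'a \<Rightarrow> 'a uprod \<Rightarrow> nat" where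
  "incidence v e = (if e = Upair v v then 2 else if v \<in> set_uprod e then 1 else 0)"

definition neighbours :: "'a mgraph \<Rightarrow> 'a \<Rightarrow> 'a set" where
  "neighbours G v = {w. adjacent G v w}"

definition wf_mgraph :: "'a mgraph \<Rightarrow> bool" where
  "wf_mgraph G \<longleftrightarrow> (\<forall>e\<in>#edges G. set_uprod e \<subseteq> verts G)"

lemma mdegree_incidence: "mdegree G v = (\<Sum>e\<in>#edges G. incidence v e)"
  by (simp add: mdegree_def incidence_def)

lemma incidence_Upair: "incidence u (Upair a b) = of_bool (u = a) + of_bool (u = b)"
  by (auto simp: incidence_def)

lemma adjacent_commute: "adjacent G u v \<longleftrightarrow> adjacent G v u"
proof -
  have "Upair u v = Upair v u"
    by simp
  then show ?thesis
    unfolding adjacent_def by (rule arg_cong)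
qed

lemma symp_adjacent: "symp (adjacent G)"
  by (auto intro: sympI simp: adjacent_commute)

lemma connected_commute: "(adjacent G)\<^sup>*\<^sup>* u v \<Longrightarrow> (adjacent G)\<^sup>*\<^sup>* v u"
  by (metis symp_adjacent symp_rtranclp sympD)

lemma sum_incidence:
  assumes "finite V" "\<forall>e\<in>#E. set_uprod e \<subseteq> V"
  shows "(\<Sum>v\<in>V. \<Sum>e\<in>#E. incidence v e) = 2 * size E"
  using assms(2)
proof (induction E)
  case (add e E)
  obtain a b where e: "e = Upair a b"
    by (cases e)
  have "(\<Sum>v\<in>V. incidence v e) = 2"
    using add.prems assms(1) by (simp add: e incidence_Upair sum.distrib of_bool_def)
  then show ?case
    using add by (simp add: sum.distrib)
qed simp

lemma incident_edges_two:
  assumes "mdegree G v = 2" "Upair v v \<notin># edges G"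
  shows "\<exists>a b. incident_edges G v = {#Upair v a, Upair v b#} \<and> a \<noteq> v \<and> b \<noteq> v"
proof -
  have "size {#e \<in># E. v \<in> set_uprod e#} = (\<Sum>e\<in>#E. incidence v e)"
    if "Upair v v \<notin># E" for E
    using that by (induction E) (auto simp: incidence_def)
  then have "size (incident_edges G v) = Suc (Suc 0)"
    using assms by (simp add: incident_edges_def mdegree_incidence)
  moreover from this obtain e N where eN: "incident_edges G v = add_mset e N"
    using size_eq_Suc_imp_eq_union by blast
  ultimately have "size N = 1"
    by simp
  then obtain f where ef: "incident_edges G v = {#e, f#}"
    using eN size_1_singleton_mset by blast
  have "\<exists>a. e' = Upair v a \<and> a \<noteq> v" if "e' \<in># incident_edges G v" for e'
    using that assms(2) by (cases e') (auto simp: incident_edges_def)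
  from this[of e] this[of f] show ?thesis
    unfolding ef by auto
qed

section \<open>Two-regular components of simple graphs are cycles\<close>

lemma card_neighbours_two:
  assumes "simple_graph G" "mdegree G v = 2"
  shows "\<exists>a b. neighbours G v = {a, b} \<and> a \<noteq> b"
proof -
  have "Upair v v \<notin># edges G"
    using assms(1) by (auto simp: simple_graph_def)
  then obtain a b where ab: "incident_edges G v = {#Upair v a, Upair v b#}" "a \<noteq> v" "b \<noteq> v"
    using incident_edges_two[OF assms(2)] by blast
  have "w \<in> neighbours G v \<longleftrightarrow> Upair v w \<in># incident_edges G v" for w
    by (auto simp: neighbours_def adjacent_def incident_edges_def)
  then have "neighbours G v = {a, b}"
    using ab by auto
  moreover have "a \<noteq> b"
  proof
    assume "a = b"
    then have "count (incident_edges G v) (Upair v a) = 2"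
      using ab by simp
    then have "count (edges G) (Upair v a) = 2"
      by (simp add: incident_edges_def)
    moreover from this have "Upair v a \<in># edges G"
      by (metis count_eq_zero_iff zero_neq_numeral)
    ultimately show False
      using assms(1) by (auto simp: simple_graph_def)
  qed
  ultimately show ?thesis
    by blast
qed

text \<open>A longest path in \<open>K\<close> does it, which need not pass through
  \<open>u\<close>. Maximality forces the second neighbour of its last vertex onto the path, and
  only the first vertex has a neighbour to spare. The path \<open>[a, u, b]\<close> shows that the
  length is at least 3.\<close>

lemma two_regular_path_closes:
  assumes nb: "\<And>x. x \<in> K \<Longrightarrow> \<exists>a b. neighbours G x = {a, b} \<and> a \<noteq> b"
    and cl: "\<And>x y. x \<in> K \<Longrightarrow> adjacent G x y \<Longrightarrow> y \<in> K"
    and fin: "finite K" and ne: "u \<in> K" and irr: "\<And>x. \<not> adjacent G x x"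
  shows "\<exists>vs. distinct vs \<and> length vs \<ge> 3 \<and> set vs \<subseteq> K \<and>
    (\<forall>i<length vs. neighbours G (vs ! i) =
      {vs ! (if i = 0 then length vs - 1 else i - 1), vs ! (Suc i mod length vs)})"
proof -
  let ?path = "\<lambda>vs. distinct vs \<and> set vs \<subseteq> K \<and>
    (\<forall>i. Suc i < length vs \<longrightarrow> adjacent G (vs ! i) (vs ! Suc i))"
  have bound: "length vs \<le> card K" if "?path vs" for vs
    using that card_mono[OF fin] distinct_card by metis
  obtain a b where ab: "neighbours G u = {a, b}" "a \<noteq> b"
    using nb[OF ne] by blast
  have ua: "adjacent G u a" and ub: "adjacent G u b"
    using ab by (auto simp: neighbours_def)
  have au: "adjacent G a u"
    using ua adjacent_commute[of G u a] by simp
  have "a \<noteq> u" "b \<noteq> u"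
    using irr[of u] ua ub by metis+
  moreover have "a \<in> K" "b \<in> K"
    using cl[OF ne ua] cl[OF ne ub] .
  moreover have "adjacent G ([a, u, b] ! i) ([a, u, b] ! Suc i)" if i: "Suc i < length [a, u, b]" for i
  proof -
    consider "i = 0" | "i = 1"
      using i by force
    then show ?thesis
      by cases (simp_all add: au ub)
  qed
  ultimately have p0: "?path [a, u, b]"
    using ab(2) ne by auto
  have "\<exists>vs. ?path vs \<and> (\<forall>ws. ?path ws \<longrightarrow> length ws \<le> length vs)"
    by (rule ex_has_greatest_nat[where P = ?path and b = "Suc (card K)", OF p0]) (use bound in \<open>blast intro: le_imp_less_Suc\<close>)
  then obtain vs where vs: "?path vs" and max: "\<And>ws. ?path ws \<Longrightarrow> length ws \<le> length vs"
    by blast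
  let ?m = "length vs"
  have m: "?m \<ge> 3"
    using max[OF p0] by simp
  have adj: "adjacent G (vs ! i) (vs ! Suc i)" if "Suc i < ?m" for i
    using vs that by blast
  have eq: "vs ! i = vs ! j \<longleftrightarrow> i = j" if "i < ?m" "j < ?m" for i j
    using vs that by (simp add: nth_eq_iff_index_eq)
  have two: "neighbours G x = {p, q}" if "x \<in> K" "adjacent G x p" "adjacent G x q" "p \<noteq> q" for x p q
  proof -
    obtain c d where "neighbours G x = {c, d}" "c \<noteq> d"
      using nb[OF \<open>x \<in> K\<close>] by blast
    moreover have "p \<in> neighbours G x" "q \<in> neighbours G x"
      using that by (auto simp: neighbours_def)
    ultimately show ?thesis
      using \<open>p \<noteq> q\<close> by auto
  qed
  have K: "vs ! i \<in> K" if "i < ?m" for i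
    using vs that by auto
  have inner: "neighbours G (vs ! i) = {vs ! (i - 1), vs ! Suc i}" if "0 < i" "Suc i < ?m" for i
  proof (rule two)
    show "adjacent G (vs ! i) (vs ! (i - 1))"
      using adj[of "i - 1"] that adjacent_commute[of G "vs ! i"] by simp
    show "vs ! (i - 1) \<noteq> vs ! Suc i"
      using eq[of "i - 1" "Suc i"] that by simp
  qed (use that in \<open>auto intro: K adj\<close>)
  let ?x = "vs ! (?m - 1)"
  have xK: "?x \<in> K"
    using K m by auto
  obtain y where y: "adjacent G ?x y" "y \<noteq> vs ! (?m - 2)"
    using nb[OF xK] by (auto simp: neighbours_def)
  have "y \<in> set vs"
  proof (rule ccontr)
    assume y_new: "y \<notin> set vs"
    have "y \<in> K"
      using cl[OF xK] y by blast
    have "adjacent G ((vs @ [y]) ! i) ((vs @ [y]) ! Suc i)" if i: "Suc i < length (vs @ [y])" for i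
    proof (cases "Suc i < ?m")
      case True
      then have "(vs @ [y]) ! i = vs ! i" "(vs @ [y]) ! Suc i = vs ! Suc i"
        by (simp_all add: nth_append)
      then show ?thesis
        using adj[OF True] by simp
    next
      case False
      then have "i = ?m - 1" "Suc i = ?m"
        using i m by auto
      then have "(vs @ [y]) ! i = ?x" "(vs @ [y]) ! Suc i = y"
        using m by (simp_all add: nth_append)
      then show ?thesis
        using y(1) by simp
    qed
    moreover have "distinct (vs @ [y])" "set (vs @ [y]) \<subseteq> K"
      using vs y_new \<open>y \<in> K\<close> by simp_all
    ultimately have "?path (vs @ [y])"
      by blast
    then have "length (vs @ [y]) \<le> ?m"
      by (rule max)
    then show False
      by simp
  qed
  then obtain j where j: "j < ?m" "y = vs ! j"
    by (metis in_set_conv_nth)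
  \<comment> \<open>At an inner position both neighbours of the vertex are next to it on the path.
    The last vertex would then have to stand next to position \<open>j\<close>, hence
    \<open>j = length vs - 2\<close>, which is excluded by the choice of \<open>y\<close>.\<close>
  have "j = 0"
  proof (rule ccontr)
    assume "j \<noteq> 0"
    have "j \<noteq> ?m - 1"
      using y j irr by auto
    then have "neighbours G (vs ! j) = {vs ! (j - 1), vs ! Suc j}"
      using inner[of j] j \<open>j \<noteq> 0\<close> by auto
    moreover have "?x \<in> neighbours G (vs ! j)"
      using y j by (simp add: neighbours_def adjacent_commute)
    ultimately have "?m - 1 = j - 1 \<or> ?m - 1 = Suc j"
      using eq[of "?m - 1" "j - 1"] eq[of "?m - 1" "Suc j"] j \<open>j \<noteq> ?m - 1\<close> by auto
    then have "j = ?m - 2"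
      using j \<open>j \<noteq> 0\<close> by linarith
    then show False
      using j y by simp
  qed
  then have x0: "adjacent G ?x (vs ! 0)"
    using y j by simp
  have "neighbours G (vs ! i) = {vs ! (if i = 0 then ?m - 1 else i - 1), vs ! (Suc i mod ?m)}"
    if i: "i < ?m" for i
  proof -
    consider "i = 0" | "i = ?m - 1" "i \<noteq> 0" | "0 < i" "Suc i < ?m"
      using i by linarith
    then show ?thesis
    proof cases
      case 1
      have "neighbours G (vs ! 0) = {?x, vs ! Suc 0}"
      proof (rule two)
        show "vs ! 0 \<in> K" "adjacent G (vs ! 0) (vs ! Suc 0)"
          using K[of 0] adj[of 0] m by linarith+
        show "adjacent G (vs ! 0) ?x"
          using x0 adjacent_commute[of G ?x] by simp
        show "?x \<noteq> vs ! Suc 0"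
          using eq[of "?m - 1" "Suc 0"] m by auto
      qed
      then show ?thesis
        using 1 m by simp
    next
      case 2
      then have "Suc i = ?m" by auto
      have "neighbours G ?x = {vs ! (?m - 1 - 1), vs ! 0}"
      proof (rule two)
        have "Suc (?m - 1 - 1) = ?m - 1"
          using m by simp
        then show "adjacent G ?x (vs ! (?m - 1 - 1))"
          using adj[of "?m - 1 - 1"] m adjacent_commute[of G ?x] by simp
        show "vs ! (?m - 1 - 1) \<noteq> vs ! 0"
          using eq[of "?m - 1 - 1" 0] m by (cases "vs = []") auto
      qed (use xK x0 in auto)
      then show ?thesis
        using 2 \<open>Suc i = ?m\<close> by simp
    next
      case 3
      then show ?thesis
        using inner by simp
    qed
  qed
  then show ?thesis
    using vs m by blast
qed

text \<open>The closed path contains all neighbours of its vertices, so by connectivity it exhausts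
  the component, and each edge joins two cyclically consecutive vertices.\<close>

lemma is_cycle_two_regular:
  assumes "simple_graph G" and u: "u \<in> verts G"
    and two: "\<And>v. (adjacent G)\<^sup>*\<^sup>* u v \<Longrightarrow> mdegree G v = 2"
  shows "is_cycle (induced_subgraph G {v \<in> verts G. (adjacent G)\<^sup>*\<^sup>* u v})"
proof -
  let ?K = "{v \<in> verts G. (adjacent G)\<^sup>*\<^sup>* u v}"
  have s: "finite (verts G)" "\<And>e. e \<in># edges G \<Longrightarrow> set_uprod e \<subseteq> verts G"
    "\<And>e. e \<in># edges G \<Longrightarrow> proper_uprod e" "\<And>e. e \<in># edges G \<Longrightarrow> count (edges G) e = 1"
    using assms(1) by (auto simp: simple_graph_def)
  have irr: "\<not> adjacent G x x" for x
    using s(3)[of "Upair x x"] by (auto simp: adjacent_def)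
  have cl: "y \<in> ?K" if xy: "x \<in> ?K" "adjacent G x y" for x y
  proof -
    have "y \<in> verts G"
      using s(2)[of "Upair x y"] xy(2) by (simp add: adjacent_def)
    moreover have "(adjacent G)\<^sup>*\<^sup>* u y"
      using xy by (metis (lifting) mem_Collect_eq rtranclp.rtrancl_into_rtrancl)
    ultimately show ?thesis
      by simp
  qed
  have "\<exists>vs. distinct vs \<and> length vs \<ge> 3 \<and> set vs \<subseteq> ?K \<and>
    (\<forall>i<length vs. neighbours G (vs ! i) =
      {vs ! (if i = 0 then length vs - 1 else i - 1), vs ! (Suc i mod length vs)})"
  proof (rule two_regular_path_closes)
    show "\<exists>a b. neighbours G x = {a, b} \<and> a \<noteq> b" if "x \<in> ?K" for x
      by (rule card_neighbours_two[OF assms(1) two]) (use that in simp)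
    show "u \<in> ?K"
      using u by simp
    show "finite ?K"
      using s(1) by simp
  qed (fact cl irr)+
  then obtain vs where vs: "distinct vs" "length vs \<ge> 3" "set vs \<subseteq> ?K"
    and nb: "\<And>i. i < length vs \<Longrightarrow> neighbours G (vs ! i) =
      {vs ! (if i = 0 then length vs - 1 else i - 1), vs ! (Suc i mod length vs)}"
    by blast
  let ?m = "length vs" and ?f = "\<lambda>i. Upair (vs ! i) (vs ! (Suc i mod length vs))"
  have "0 < ?m"
    using vs(2) by linarith
  have closed: "y \<in> set vs" if xy: "x \<in> set vs" "adjacent G x y" for x y
  proof -
    obtain i where i: "i < ?m" "x = vs ! i"
      using xy(1) by (metis in_set_conv_nth)
    have "y \<in> neighbours G (vs ! i)"
      using xy(2) i by (simp add: neighbours_def)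
    moreover have "(if i = 0 then ?m - 1 else i - 1) < ?m"
      using i(1) by auto
    moreover have "Suc i mod ?m < ?m"
      by (rule mod_less_divisor) fact
    ultimately show ?thesis
      unfolding nb[OF i(1)] by (elim insertE emptyE) (simp_all only: nth_mem)
  qed
  from \<open>0 < ?m\<close> have 0: "vs ! 0 \<in> set vs"
    by (rule nth_mem)
  then have 1: "(adjacent G)\<^sup>*\<^sup>* (vs ! 0) u"
    using vs(3) by (intro connected_commute[of G u]) blast
  have "x \<in> set vs" if "(adjacent G)\<^sup>*\<^sup>* (vs ! 0) x" for x
    using that
  proof (induction rule: rtranclp_induct)
    case (step y z)
    then show ?case
      by (blast intro: closed)
  qed (fact 0)
  moreover have "(adjacent G)\<^sup>*\<^sup>* (vs ! 0) x" if "x \<in> ?K" for x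
    using that rtranclp_trans[OF 1] by simp
  ultimately have K: "?K = set vs"
    using vs(3) by blast
  \<comment> \<open>This needs length at least 3: with two vertices, the edges at positions 0 and 1
    would coincide, and the multiset in \<open>is_cycle\<close> would count that edge twice.\<close>
  have inj: "inj_on ?f {0..<?m}"
  proof (rule inj_onI)
    fix i j
    assume ij: "i \<in> {0..<?m}" "j \<in> {0..<?m}" "?f i = ?f j"
    have idx: "vs ! k = vs ! l \<longleftrightarrow> k = l" if "k < ?m" "l < ?m" for k l
      using vs that by (simp add: nth_eq_iff_index_eq)
    have md: "Suc k mod ?m = (if Suc k = ?m then 0 else Suc k)" if "k < ?m" for k
      using that by (cases "Suc k = ?m") auto
    have lt: "i < ?m" "j < ?m" "Suc i mod ?m < ?m" "Suc j mod ?m < ?m"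
      using ij(1,2) mod_less_divisor[OF \<open>0 < ?m\<close>] by simp_all
    consider "vs ! i = vs ! j" | "vs ! i = vs ! (Suc j mod ?m)" "vs ! (Suc i mod ?m) = vs ! j"
      using ij(3) unfolding Upair_inject by blast
    then show "i = j"
    proof cases
      case 1
      then show ?thesis
        using idx[OF lt(1,2)] by blast
    next
      case 2
      have "i = (if Suc j = ?m then 0 else Suc j)"
        unfolding md[OF lt(2), symmetric] by (rule iffD1[OF idx[OF lt(1,4)] 2(1)])
      then have i: "Suc j = ?m \<and> i = 0 \<or> i = Suc j"
        by (cases "Suc j = ?m") simp_all
      have "(if Suc i = ?m then 0 else Suc i) = j"
        unfolding md[OF lt(1), symmetric] by (rule iffD1[OF idx[OF lt(3,2)] 2(2)])
      then have "Suc i = ?m \<and> j = 0 \<or> j = Suc i"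
        by (cases "Suc i = ?m") simp_all
      with i show ?thesis
        using vs(2) by linarith
    qed
  qed
  have "{#e \<in># edges G. set_uprod e \<subseteq> ?K#} = image_mset ?f (mset [0..<?m])"
  proof -
    have "{#e \<in># edges G. set_uprod e \<subseteq> ?K#} = mset_set {e \<in> set_mset (edges G). set_uprod e \<subseteq> ?K}"
      using s(4) by (intro multiset_eqI) (auto simp: count_mset_set' not_in_iff)
    also have "{e \<in> set_mset (edges G). set_uprod e \<subseteq> ?K} = ?f ` {0..<?m}"
    proof (intro equalityI subsetI)
      fix e
      assume e: "e \<in> {e \<in> set_mset (edges G). set_uprod e \<subseteq> ?K}"
      obtain x y where xy: "e = Upair x y"
        by (cases e)
      then have "x \<in> set vs" and xy': "adjacent G x y"
        using e K by (auto simp: adjacent_def)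
      then obtain i where i: "i < ?m" "x = vs ! i"
        by (metis in_set_conv_nth)
      then have "y \<in> {vs ! (if i = 0 then ?m - 1 else i - 1), vs ! (Suc i mod ?m)}"
        using nb[OF i(1)] xy' by (auto simp: neighbours_def)
      then consider "y = vs ! (Suc i mod ?m)" | "y = vs ! (if i = 0 then ?m - 1 else i - 1)"
        by blast
      then show "e \<in> ?f ` {0..<?m}"
      proof cases
        case 1
        then show ?thesis
          using xy i by auto
      next
        case 2
        let ?j = "if i = 0 then ?m - 1 else i - 1"
        have "?j < ?m" "Suc ?j mod ?m = i"
          using i vs(2) by auto
        then have "e = ?f ?j"
          using xy i 2 by (metis Upair_inject)
        then show ?thesis
          by (rule image_eqI) (use \<open>?j < ?m\<close> in simp)
      qed
    next
      fix e
      assume "e \<in> ?f ` {0..<?m}"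
      then obtain i where i: "i < ?m" "e = ?f i"
        by auto
      have "adjacent G (vs ! i) (vs ! (Suc i mod ?m))"
        using nb[OF i(1)] by (auto simp: neighbours_def)
      moreover have "vs ! i \<in> ?K" "vs ! (Suc i mod ?m) \<in> ?K"
        unfolding K using i mod_less_divisor[OF \<open>0 < ?m\<close>] by (simp_all only: nth_mem)
      ultimately show "e \<in> {e \<in> set_mset (edges G). set_uprod e \<subseteq> ?K}"
        by (simp add: i(2) adjacent_def)
    qed
    also have "mset_set (?f ` {0..<?m}) = image_mset ?f (mset_set {0..<?m})"
      using inj by (simp add: image_mset_mset_set)
    finally show ?thesis
      by simp
  qed
  then show ?thesis
    unfolding is_cycle_def induced_subgraph_def mgraph.sel using vs(1,2) K by blast
qed


text \<open>The invariant \<open>nonreg\<close> says that no component is 2-regular. It excludes a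
  loop at \<open>v\<close>, since a loop would use up the degree of \<open>v\<close> and make it a
  component of its own; hence \<open>suppress_eq\<close> applies. The invariant persists because the
  other vertices keep their degrees and stay connected as before.\<close>

lemma suppress_step:
  assumes wf: "wf_mgraph G" and v: "v \<in> verts G" "mdegree G v = 2"
    and nonreg: "\<And>u. u \<in> verts G \<Longrightarrow> \<exists>w\<in>verts G. (adjacent G)\<^sup>*\<^sup>* u w \<and> mdegree G w \<noteq> 2"
  defines "G' \<equiv> suppress v G"
  shows "verts G' = verts G - {v}"
    and "wf_mgraph G'"
    and "\<And>u. u \<noteq> v \<Longrightarrow> mdegree G' u = mdegree G u"
    and "\<And>u w. adjacent G' u w \<Longrightarrow> (adjacent G)\<^sup>*\<^sup>* u w"
    and "\<And>u. u \<in> verts G' \<Longrightarrow> \<exists>w\<in>verts G'. (adjacent G')\<^sup>*\<^sup>* u w \<and> mdegree G' w \<noteq> 2"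
proof -
  have noloop: "Upair v v \<notin># edges G"
  proof
    assume loop: "Upair v v \<in># edges G"
    then obtain E where E: "edges G = add_mset (Upair v v) E"
      by (metis insert_DiffM)
    then have 0: "\<forall>e\<in>#E. incidence v e = 0"
      using v(2) by (simp add: mdegree_incidence incidence_Upair)
    have vx: "x = v" if x: "adjacent G v x" for x
    proof (rule ccontr)
      assume "x \<noteq> v"
      then have "Upair v x \<in># E"
        using x E by (auto simp: adjacent_def)
      then have "incidence v (Upair v x) = 0"
        using 0 by blast
      then show False
        by (simp add: incidence_Upair)
    qed
    have "x = v" if "(adjacent G)\<^sup>*\<^sup>* v x" for x
      using that
    proof (induction rule: rtranclp_induct)
      case (step y z)
      then show ?case
        using vx[of z] by simp
    qed simp
    then show False
      using nonreg[OF v(1)] v(2) by blast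
  qed
  then obtain a b where ab: "incident_edges G v = {#Upair v a, Upair v b#}" "a \<noteq> v" "b \<noteq> v"
    using incident_edges_two[OF v(2)] by blast
  define E where "E = {#e \<in># edges G. v \<notin> set_uprod e#}"
  have edges: "edges G = {#Upair v a, Upair v b#} + E"
    unfolding E_def ab(1)[symmetric] incident_edges_def by (rule multiset_partition)
  have G': "G' = MGraph (verts G - {v}) (add_mset (Upair a b) E)"
    unfolding G'_def suppress_eq[OF ab(1)] edges by simp
  have vE: "v \<notin> set_uprod e" if "e \<in># E" for e
    using that by (simp add: E_def)
  show vG': "verts G' = verts G - {v}"
    by (simp add: G')
  have sub: "set_uprod e \<subseteq> verts G" if "e \<in># edges G" for e
    using wf that by (simp add: wf_mgraph_def)
  have "a \<in> verts G" "b \<in> verts G"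
    using sub[of "Upair v a"] sub[of "Upair v b"] by (simp_all add: edges)
  then show "wf_mgraph G'"
    using sub vE ab(2,3) unfolding wf_mgraph_def G' edges by fastforce
  show deg: "mdegree G' u = mdegree G u" if "u \<noteq> v" for u
    using that by (simp add: mdegree_incidence G' edges incidence_Upair)
  have vab: "adjacent G v a" "adjacent G v b" "adjacent G a v" "adjacent G b v"
    by (simp_all add: adjacent_def edges)
  show "(adjacent G)\<^sup>*\<^sup>* u w" if uw: "adjacent G' u w" for u w
  proof -
    consider "Upair u w = Upair a b" | "Upair u w \<in># E"
      using uw by (auto simp: adjacent_def G')
    then show ?thesis
    proof cases
      case 1
      then have "adjacent G u v" "adjacent G v w"
        using vab by auto
      then show ?thesis
        by (meson converse_rtranclp_into_rtranclp r_into_rtranclp)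
    next
      case 2
      then have "adjacent G u w"
        by (simp add: adjacent_def edges)
      then show ?thesis
        by (rule r_into_rtranclp)
    qed
  qed
  have ab': "adjacent G' a b" "adjacent G' b a"
    by (simp_all add: adjacent_def G')
  have nbv: "w = a \<or> w = b" if w: "adjacent G v w" for w
  proof -
    have "Upair v w \<in># incident_edges G v"
      using w by (simp add: adjacent_def incident_edges_def)
    then show ?thesis
      unfolding ab(1) by auto
  qed
  have old: "adjacent G' x y" if "adjacent G x y" "x \<noteq> v" "y \<noteq> v" for x y
    using that by (auto simp: adjacent_def G' E_def)
  \<comment> \<open>Walks are rerouted around \<open>v\<close>. A walk that has just arrived at
    \<open>v\<close> may continue to \<open>a\<close> or to \<open>b\<close>, so the induction
    carries along that both can be reached in the new graph.\<close>
  have conn: "(w \<noteq> v \<longrightarrow> (adjacent G')\<^sup>*\<^sup>* u w) \<and>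
      (w = v \<longrightarrow> (adjacent G')\<^sup>*\<^sup>* u a \<and> (adjacent G')\<^sup>*\<^sup>* u b)"
    if uw: "(adjacent G)\<^sup>*\<^sup>* u w" "u \<noteq> v" for u w
    using uw(1)
  proof induction
    case base
    then show ?case
      using uw(2) by simp
  next
    case (step y z)
    consider "y \<noteq> v" "z \<noteq> v" | "y \<noteq> v" "z = v" | "y = v" "z \<noteq> v" | "y = v" "z = v"
      by blast
    then show ?case
    proof cases
      case 1
      then show ?thesis
        using step.IH old[OF step.hyps(2)] by (auto intro: rtranclp.rtrancl_into_rtrancl)
    next
      case 2
      then have "adjacent G v y"
        using step.hyps(2) adjacent_commute[of G y v] by simp
      then have "y = a \<or> y = b"
        by (rule nbv)
      then show ?thesis
        using 2 step.IH ab' by (auto intro: rtranclp.rtrancl_into_rtrancl)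
    next
      case 3
      then show ?thesis
        using step.IH nbv[of z] step.hyps(2) by auto
    next
      case 4
      then show ?thesis
        using step.IH by simp
    qed
  qed
  show "\<exists>w\<in>verts G'. (adjacent G')\<^sup>*\<^sup>* u w \<and> mdegree G' w \<noteq> 2" if u: "u \<in> verts G'" for u
  proof -
    have u': "u \<in> verts G" "u \<noteq> v"
      using u vG' by auto
    obtain w where w: "w \<in> verts G" "(adjacent G)\<^sup>*\<^sup>* u w" "mdegree G w \<noteq> 2"
      using nonreg[OF u'(1)] by blast
    then have "w \<noteq> v"
      using v(2) by blast
    then show ?thesis
      using conn[OF w(2) u'(2)] w deg vG' by auto
  qed
qed

lemma fold_suppress:
  assumes "wf_mgraph G" "distinct zs" "\<And>z. z \<in> set zs \<Longrightarrow> z \<in> verts G \<and> mdegree G z = 2"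
    and "\<And>u. u \<in> verts G \<Longrightarrow> \<exists>w\<in>verts G. (adjacent G)\<^sup>*\<^sup>* u w \<and> mdegree G w \<noteq> 2"
  defines "G' \<equiv> fold suppress zs G"
  shows "verts G' = verts G - set zs \<and> (\<forall>u\<in>verts G'. mdegree G' u = mdegree G u) \<and>
    (\<forall>u w. adjacent G' u w \<longrightarrow> (adjacent G)\<^sup>*\<^sup>* u w)"
  using assms(1-4) unfolding G'_def
proof (induction zs arbitrary: G)
  case (Cons z zs)
  let ?G = "suppress z G" and ?H = "fold suppress zs (suppress z G)"
  have z: "z \<in> verts G" "mdegree G z = 2"
    using Cons.prems(3)[of z] by simp_all
  note st = suppress_step[OF Cons.prems(1) z Cons.prems(4)]
  have H: "verts ?H = verts ?G - set zs \<and> (\<forall>u\<in>verts ?H. mdegree ?H u = mdegree ?G u) \<and>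
    (\<forall>u w. adjacent ?H u w \<longrightarrow> (adjacent ?G)\<^sup>*\<^sup>* u w)"
  proof (rule Cons.IH)
    show "w \<in> verts ?G \<and> mdegree ?G w = 2" if "w \<in> set zs" for w
    proof -
      have "w \<noteq> z"
        using Cons.prems(2) that by auto
      then show ?thesis
        using st(1,3) Cons.prems(3)[of w] that by simp
    qed
  qed (use st Cons.prems(2) in simp_all)
  have trans: "(adjacent ?G)\<^sup>*\<^sup>* u w \<Longrightarrow> (adjacent G)\<^sup>*\<^sup>* u w" for u w
  proof (induction rule: rtranclp_induct)
    case (step x y)
    then show ?case
      using rtranclp_trans[OF step.IH st(4)] by blast
  qed simp
  have "verts ?H = verts G - set (z # zs)"
    using H st(1) by auto
  moreover have "mdegree ?H u = mdegree G u" if "u \<in> verts ?H" for u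
    using H st(1) st(3)[of u] that by auto
  ultimately show ?case
    using H trans by simp
qed auto

text \<open>The deleted vertices form a union of components, so no edge joins them to the rest and
  degrees are kept. A remaining 2-regular component would be a cycle by
  \<open>is_cycle_two_regular\<close>; this supplies the invariant with which the suppressions
  start.\<close>

lemma delete_cycle_components_props:
  assumes "simple_graph G"
  defines "G' \<equiv> delete_cycle_components G"
  shows "wf_mgraph G'" and "verts G' \<subseteq> verts G"
    and "\<And>u w. adjacent G' u w \<Longrightarrow> adjacent G u w"
    and "\<And>u. u \<in> verts G' \<Longrightarrow> mdegree G' u = mdegree G u"
    and "\<And>u. u \<in> verts G' \<Longrightarrow> \<exists>w\<in>verts G'. (adjacent G')\<^sup>*\<^sup>* u w \<and> mdegree G' w \<noteq> 2"
proof -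
  let ?comp = "\<lambda>u. {v \<in> verts G. (adjacent G)\<^sup>*\<^sup>* u v}"
  define U where "U = \<Union> (verts ` {C \<in> graph_components G. is_cycle C})"
  have G': "G' = induced_subgraph G (verts G - U)"
    by (simp add: G'_def delete_cycle_components_def U_def)
  have vG': "verts G' = verts G - U"
    by (simp add: G' induced_subgraph_def)
  have eG': "edges G' = {#e \<in># edges G. set_uprod e \<subseteq> verts G - U#}"
    by (simp add: G' induced_subgraph_def)
  show "wf_mgraph G'"
    by (simp add: wf_mgraph_def vG' eG')
  show "verts G' \<subseteq> verts G"
    by (auto simp: vG')
  show "adjacent G u w" if "adjacent G' u w" for u w
    using that by (simp add: adjacent_def eG')
  have sub: "set_uprod e \<subseteq> verts G" if "e \<in># edges G" for e
    using assms(1) that by (simp add: simple_graph_def)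
  have U: "x \<in> U \<longleftrightarrow> (\<exists>u\<in>verts G. is_cycle (induced_subgraph G (?comp u)) \<and> x \<in> ?comp u)" for x
    unfolding U_def graph_components_def by (auto simp: induced_subgraph_def)
  have UI: "y \<in> U" if xy: "x \<in> U" "adjacent G x y" for x y
  proof -
    have "y \<in> verts G"
      using sub[of "Upair x y"] xy(2) by (simp add: adjacent_def)
    moreover obtain u where u: "u \<in> verts G" "is_cycle (induced_subgraph G (?comp u))" "x \<in> ?comp u"
      using xy(1) unfolding U by blast
    moreover have "(adjacent G)\<^sup>*\<^sup>* u y"
      using u(3) rtranclp.rtrancl_into_rtrancl[of "adjacent G" u x y] xy(2) by simp
    ultimately show ?thesis
      unfolding U by blast
  qed
  have out: "y \<in> verts G - U" if xy: "x \<in> verts G - U" "adjacent G x y" for x y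
  proof -
    have "y \<in> verts G"
      using sub[of "Upair x y"] xy(2) by (simp add: adjacent_def)
    moreover have "adjacent G y x"
      using xy(2) adjacent_commute[of G x y] by simp
    ultimately show ?thesis
      using UI[of y x] xy(1) by blast
  qed
  have keep: "set_uprod e \<subseteq> verts G - U" if e: "e \<in># edges G" "u \<in> set_uprod e" "u \<in> verts G - U" for e u
  proof -
    obtain x y where xy: "e = Upair x y"
      by (cases e)
    then have "adjacent G x y"
      using e(1) by (simp add: adjacent_def)
    then have adj: "adjacent G x y" "adjacent G y x"
      using adjacent_commute[of G x y] by simp_all
    have "u = x \<or> u = y"
      using e(2) xy by simp
    then have "x \<in> verts G - U \<and> y \<in> verts G - U"
      using out[OF _ adj(1)] out[OF _ adj(2)] e(3) by blast
    then show ?thesis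
      by (simp add: xy)
  qed
  show deg: "mdegree G' u = mdegree G u" if u: "u \<in> verts G'" for u
  proof -
    let ?in = "\<lambda>e. set_uprod e \<subseteq> verts G - U"
    have "incidence u e = 0" if "e \<in># filter_mset (\<lambda>e. \<not> ?in e) (edges G)" for e
    proof -
      have "u \<notin> set_uprod e"
        using keep[of e u] that u vG' by auto
      then show ?thesis
        by (auto simp: incidence_def)
    qed
    then have "(\<Sum>e\<in>#filter_mset (\<lambda>e. \<not> ?in e) (edges G). incidence u e) = 0"
      by (simp add: sum_mset.neutral)
    then have "(\<Sum>e\<in>#filter_mset ?in (edges G) + filter_mset (\<lambda>e. \<not> ?in e) (edges G). incidence u e) =
        (\<Sum>e\<in>#filter_mset ?in (edges G). incidence u e)"
      by (simp only: image_mset_union sum_mset.union add_0_right)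
    then show ?thesis
      unfolding multiset_partition[symmetric] mdegree_incidence eG' by (rule sym)
  qed
  have reach: "w \<in> verts G - U \<and> (adjacent G')\<^sup>*\<^sup>* u w"
    if uw: "(adjacent G)\<^sup>*\<^sup>* u w" "u \<in> verts G - U" for u w
    using uw(1)
  proof induction
    case base
    then show ?case
      using uw(2) by simp
  next
    case (step y z)
    then have z: "z \<in> verts G - U"
      using out by blast
    then have "adjacent G' y z"
      using step by (simp add: adjacent_def eG')
    then show ?case
      using z rtranclp.rtrancl_into_rtrancl[of "adjacent G'" u y z] step.IH by blast
  qed
  show "\<exists>w\<in>verts G'. (adjacent G')\<^sup>*\<^sup>* u w \<and> mdegree G' w \<noteq> 2" if u: "u \<in> verts G'" for u
  proof (rule ccontr)
    assume no: "\<not> ?thesis"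
    have uU: "u \<in> verts G - U"
      using u vG' by simp
    have "mdegree G v = 2" if uv: "(adjacent G)\<^sup>*\<^sup>* u v" for v
    proof -
      have v: "v \<in> verts G'" "(adjacent G')\<^sup>*\<^sup>* u v"
        using reach[OF uv uU] vG' by simp_all
      then have "mdegree G' v = 2"
        using no by blast
      then show ?thesis
        using deg[OF v(1)] by simp
    qed
    then have "is_cycle (induced_subgraph G (?comp u))"
      using is_cycle_two_regular[OF assms(1)] uU by blast
    then have "u \<in> U"
      unfolding U using uU by blast
    then show False
      using uU by blast
  qed
qed

text \<open>These three facts are all that is needed of \<open>reduced_graph\<close>: suppressing
  vertices neither joins different components of \<open>G\<close> nor alters the remaining degrees,
  and the handshake identity inside \<open>C\<close> bounds its number of edges.\<close>

lemma component_of_reduced_graph: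
  fixes G :: "'a::linorder mgraph"
  assumes G: "simple_graph G" and C: "C \<in> graph_components (reduced_graph G)"
  shows "verts C \<subseteq> {v \<in> verts G. mdegree G v \<noteq> 2}"
    and "\<And>u w. u \<in> verts C \<Longrightarrow> w \<in> verts C \<Longrightarrow> (adjacent G)\<^sup>*\<^sup>* u w"
    and "2 * size (edges C) \<le> (\<Sum>v\<in>verts C. mdegree G v)"
proof -
  let ?G = "delete_cycle_components G" and ?H = "reduced_graph G"
  let ?Z = "{v \<in> verts ?G. mdegree ?G v = 2}"
  note d = delete_cycle_components_props[OF G]
  have fin: "finite (verts ?G)"
    using d(2) G finite_subset by (auto simp: simple_graph_def)
  have H: "?H = fold suppress (sorted_list_of_set ?Z) ?G"
    by (simp add: reduced_graph_def suppress_all_def)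
  have set_Z: "set (sorted_list_of_set ?Z) = ?Z"
    using fin by simp
  have f: "verts ?H = verts ?G - ?Z" "\<And>u. u \<in> verts ?H \<Longrightarrow> mdegree ?H u = mdegree ?G u"
    "\<And>u w. adjacent ?H u w \<Longrightarrow> (adjacent ?G)\<^sup>*\<^sup>* u w"
    using fold_suppress[OF d(1) distinct_sorted_list_of_set _ d(5), of ?Z] fin
    unfolding H[symmetric] set_Z by auto
  obtain u where u: "u \<in> verts ?H" "C = induced_subgraph ?H {v \<in> verts ?H. (adjacent ?H)\<^sup>*\<^sup>* u v}"
    using C by (auto simp: graph_components_def)
  have vC: "verts C = {v \<in> verts ?H. (adjacent ?H)\<^sup>*\<^sup>* u v}"
    using u by (simp add: induced_subgraph_def)
  have eC: "edges C = {#e \<in># edges ?H. set_uprod e \<subseteq> verts C#}"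
    using u vC by (simp add: induced_subgraph_def)
  show V: "verts C \<subseteq> {v \<in> verts G. mdegree G v \<noteq> 2}"
    using vC f(1) d(2,4) by auto
  have mono: "(adjacent ?G)\<^sup>*\<^sup>* x y \<Longrightarrow> (adjacent G)\<^sup>*\<^sup>* x y" for x y
    using mono_rtranclp[of "adjacent ?G" "adjacent G"] d(3) by blast
  have conn: "(adjacent ?H)\<^sup>*\<^sup>* x y \<Longrightarrow> (adjacent G)\<^sup>*\<^sup>* x y" for x y
  proof (induction rule: rtranclp_induct)
    case (step y z)
    then show ?case
      using rtranclp_trans[OF step.IH mono[OF f(3)]] by blast
  qed simp
  show "(adjacent G)\<^sup>*\<^sup>* x y" if "x \<in> verts C" "y \<in> verts C" for x y
  proof (rule rtranclp_trans)
    show "(adjacent G)\<^sup>*\<^sup>* x u" "(adjacent G)\<^sup>*\<^sup>* u y"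
      using that conn connected_commute[of G u x] unfolding vC by simp_all
  qed
  have "2 * size (edges C) = (\<Sum>v\<in>verts C. \<Sum>e\<in>#edges C. incidence v e)"
  proof (rule sum_incidence[symmetric])
    show "finite (verts C)"
      using V G by (auto simp: simple_graph_def intro: finite_subset)
  qed (simp add: eC)
  also have "\<dots> \<le> (\<Sum>v\<in>verts C. mdegree G v)"
  proof (rule sum_mono)
    fix v
    assume v: "v \<in> verts C"
    have "(\<Sum>e\<in>#edges C. incidence v e) \<le> (\<Sum>e\<in>#edges C. incidence v e) +
        (\<Sum>e\<in>#{#e \<in># edges ?H. \<not> set_uprod e \<subseteq> verts C#}. incidence v e)"
      by simp
    also have "\<dots> = (\<Sum>e\<in>#edges ?H. incidence v e)"
      unfolding eC sum_mset.union[symmetric] image_mset_union[symmetric]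
        multiset_partition[symmetric] ..
    also have "\<dots> = mdegree G v"
      using v vC f(1,2) d(4) by (simp add: mdegree_incidence[symmetric])
    finally show "(\<Sum>e\<in>#edges C. incidence v e) \<le> mdegree G v" .
  qed
  finally show "2 * size (edges C) \<le> (\<Sum>v\<in>verts C. mdegree G v)" .
qed

section \<open>Simple pairings of half-edges\<close>

definition half_edges :: "nat \<Rightarrow> (nat \<Rightarrow> nat) \<Rightarrow> (nat \<times> nat) set" where
  "half_edges n d = (SIGMA v:{1..n}. {..<d v})"

text \<open>Being the identity off the half-edges makes each pairing correspond to exactly one
  function, so that they can be counted. The last two conditions exclude loops and parallel
  edges.\<close>

definition simple_pairings :: "nat \<Rightarrow> (nat \<Rightarrow> nat) \<Rightarrow> (nat \<times> nat \<Rightarrow> nat \<times> nat) set" where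
  "simple_pairings n d = {\<sigma>. pairing (half_edges n d) \<sigma> \<and> (\<forall>x. x \<notin> half_edges n d \<longrightarrow> \<sigma> x = x) \<and>
     (\<forall>x\<in>half_edges n d. fst (\<sigma> x) \<noteq> fst x) \<and>
     (\<forall>x\<in>half_edges n d. \<forall>y\<in>half_edges n d. fst x = fst y \<longrightarrow> fst (\<sigma> x) = fst (\<sigma> y) \<longrightarrow> x = y)}"

text \<open>Both half-edges of an edge have it as image; passing through a set counts it once. This
  is faithful only for simple pairings, where no two edges are parallel.\<close>

definition pairing_graph :: "nat \<Rightarrow> (nat \<Rightarrow> nat) \<Rightarrow> (nat \<times> nat \<Rightarrow> nat \<times> nat) \<Rightarrow> nat mgraph" where
  "pairing_graph n d \<sigma> =
     MGraph {1..n} (mset_set ((\<lambda>x. Upair (fst x) (fst (\<sigma> x))) ` half_edges n d))"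

lemma half_edges_iff: "(v, i) \<in> half_edges n d \<longleftrightarrow> v \<in> {1..n} \<and> i < d v"
  by (simp add: half_edges_def)

lemma finite_half_edges: "finite (half_edges n d)"
  by (simp add: half_edges_def)

lemma half_edges_at: "v \<in> {1..n} \<Longrightarrow> {x \<in> half_edges n d. fst x = v} = Pair v ` {..<d v}"
  by (auto simp: half_edges_def)

lemma card_half_edges_at:
  "card {x \<in> half_edges n d. fst x = v} = (if v \<in> {1..n} then d v else 0)"
proof (cases "v \<in> {1..n}")
  case True
  then show ?thesis
    by (simp add: half_edges_at card_image inj_on_def)
next
  case False
  then have "{x \<in> half_edges n d. fst x = v} = {}"
    by (auto simp: half_edges_def)
  then show ?thesis
    unfolding \<open>{x \<in> half_edges n d. fst x = v} = {}\<close> using False by (simp only: card.empty if_False)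
qed

lemma simple_pairingsD:
  assumes "\<sigma> \<in> simple_pairings n d"
  shows "pairing (half_edges n d) \<sigma>"
    and "x \<notin> half_edges n d \<Longrightarrow> \<sigma> x = x"
    and "x \<in> half_edges n d \<Longrightarrow> \<sigma> x \<in> half_edges n d"
    and "x \<in> half_edges n d \<Longrightarrow> \<sigma> (\<sigma> x) = x"
    and "x \<in> half_edges n d \<Longrightarrow> fst (\<sigma> x) \<noteq> fst x"
    and "x \<in> half_edges n d \<Longrightarrow> y \<in> half_edges n d \<Longrightarrow> fst x = fst y \<Longrightarrow>
      fst (\<sigma> x) = fst (\<sigma> y) \<Longrightarrow> x = y"
  using assms unfolding simple_pairings_def pairing_def mem_Collect_eq by blast+

lemma mdegree_simple:
  assumes "simple_graph G"
  shows "mdegree G v = card (neighbours G v)"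
proof -
  have s: "count (edges G) e = 1" "proper_uprod e" if "e \<in># edges G" for e
    using assms that by (auto simp: simple_graph_def)
  have "incidence v e = of_bool (v \<in> set_uprod e)" if "e \<in># edges G" for e
    using s(2)[OF that] by (auto simp: incidence_def)
  then have "mdegree G v = (\<Sum>e\<in>#edges G. of_bool (v \<in> set_uprod e))"
    unfolding mdegree_incidence by (intro arg_cong[where f = sum_mset] image_mset_cong)
  also have "\<dots> = (\<Sum>e\<in>set_mset (edges G). of_bool (v \<in> set_uprod e))"
  proof -
    have "edges G = mset_set (set_mset (edges G))"
      using s(1) by (intro multiset_eqI) (auto simp: count_mset_set' not_in_iff)
    then show ?thesis
      by (metis sum_unfold_sum_mset)
  qed
  also have "\<dots> = card {e \<in> set_mset (edges G). v \<in> set_uprod e}"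
    by (simp add: sum.If_cases Int_def of_bool_def)
  also have "{e \<in> set_mset (edges G). v \<in> set_uprod e} = Upair v ` neighbours G v"
  proof (intro equalityI subsetI)
    fix e
    assume e: "e \<in> {e \<in> set_mset (edges G). v \<in> set_uprod e}"
    obtain x y where xy: "e = Upair x y"
      by (cases e)
    then have "v = x \<or> v = y"
      using e by auto
    then obtain w where "e = Upair v w"
      using xy by auto
    then show "e \<in> Upair v ` neighbours G v"
      using e by (auto simp: neighbours_def adjacent_def)
  qed (auto simp: neighbours_def adjacent_def)
  also have "card \<dots> = card (neighbours G v)"
    by (rule card_image) (auto simp: inj_on_def)
  finally show ?thesis .
qed

lemma adjacent_pairing_graph:
  assumes "\<sigma> \<in> simple_pairings n d"
  shows "adjacent (pairing_graph n d \<sigma>) u w \<longleftrightarrow> (\<exists>x\<in>half_edges n d. fst x = u \<and> fst (\<sigma> x) = w)"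
proof
  assume "adjacent (pairing_graph n d \<sigma>) u w"
  then obtain x where x: "x \<in> half_edges n d" "Upair u w = Upair (fst x) (fst (\<sigma> x))"
    by (auto simp: adjacent_def pairing_graph_def finite_half_edges simp del: Upair_inject)
  then consider "u = fst x" "w = fst (\<sigma> x)" | "u = fst (\<sigma> x)" "w = fst x"
    unfolding Upair_inject by blast
  then show "\<exists>x\<in>half_edges n d. fst x = u \<and> fst (\<sigma> x) = w"
  proof cases
    case 2
    then show ?thesis
      using simple_pairingsD(3,4)[OF assms x(1)] by (intro bexI[of _ "\<sigma> x"]) simp_all
  qed (use x(1) in blast)
next
  assume "\<exists>x\<in>half_edges n d. fst x = u \<and> fst (\<sigma> x) = w"
  then show "adjacent (pairing_graph n d \<sigma>) u w"
    by (auto simp: adjacent_def pairing_graph_def finite_half_edges)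
qed

lemma pairing_graph_realizes:
  assumes \<sigma>: "\<sigma> \<in> simple_pairings n d"
  shows "pairing_graph n d \<sigma> \<in> realizations n d"
proof -
  let ?G = "pairing_graph n d \<sigma>" and ?X = "half_edges n d"
  have e: "set_uprod e \<subseteq> {1..n} \<and> proper_uprod e \<and> count (edges ?G) e = 1" if e: "e \<in># edges ?G" for e
  proof -
    obtain x where x: "x \<in> ?X" "e = Upair (fst x) (fst (\<sigma> x))"
      using e by (auto simp: pairing_graph_def finite_half_edges)
    have "fst x \<in> {1..n}" "fst (\<sigma> x) \<in> {1..n}"
      using x(1) simple_pairingsD(3)[OF \<sigma> x(1)] by (auto simp: half_edges_def)
    moreover have "count (edges ?G) e = 1"
      using e by (simp add: pairing_graph_def finite_half_edges)
    ultimately show ?thesis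
      using simple_pairingsD(5)[OF \<sigma> x(1)] by (simp add: x(2))
  qed
  then have s: "simple_graph ?G"
    by (simp add: simple_graph_def) (simp add: pairing_graph_def)
  have "mdegree ?G v = d v" if "v \<in> {1..n}" for v
  proof -
    have "neighbours ?G v = (\<lambda>x. fst (\<sigma> x)) ` {x \<in> ?X. fst x = v}"
      unfolding neighbours_def adjacent_pairing_graph[OF \<sigma>] by auto
    moreover have "inj_on (\<lambda>x. fst (\<sigma> x)) {x \<in> ?X. fst x = v}"
      using simple_pairingsD(6)[OF \<sigma>] by (auto intro!: inj_onI)
    ultimately show ?thesis
      using that by (simp add: mdegree_simple[OF s] card_image card_half_edges_at)
  qed
  then show ?thesis
    using s by (simp add: realizations_def) (simp add: pairing_graph_def)
qed

text \<open>A simple pairing over \<open>G\<close> amounts to an ordering of the neighbours of each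
  vertex, the \<open>i\<close>-th one being where half-edge \<open>(v, i)\<close> leads. So its
  number of choices depends on the degrees only.\<close>

definition adjacency_lists :: "nat \<Rightarrow> (nat \<Rightarrow> nat) \<Rightarrow> nat mgraph \<Rightarrow> (nat \<Rightarrow> nat list) set" where
  "adjacency_lists n d G =
     (\<Pi>\<^sub>E v\<in>{1..n}. {xs. length xs = d v \<and> distinct xs \<and> set xs \<subseteq> neighbours G v})"

definition lists_of_pairing ::
    "nat \<Rightarrow> (nat \<Rightarrow> nat) \<Rightarrow> (nat \<times> nat \<Rightarrow> nat \<times> nat) \<Rightarrow> nat \<Rightarrow> nat list" where
  "lists_of_pairing n d \<sigma> = (\<lambda>v\<in>{1..n}. map (\<lambda>i. fst (\<sigma> (v, i))) [0..<d v])"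

lemma realizationsD:
  assumes "G \<in> realizations n d"
  shows "simple_graph G" "verts G = {1..n}" "v \<in> {1..n} \<Longrightarrow> card (neighbours G v) = d v"
    "neighbours G v \<subseteq> {1..n}" "v \<notin> neighbours G v" "w \<in> neighbours G v \<longleftrightarrow> v \<in> neighbours G w"
proof -
  show s: "simple_graph G" and v: "verts G = {1..n}"
    using assms by (auto simp: realizations_def)
  show "card (neighbours G v) = d v" if "v \<in> {1..n}"
    using assms that mdegree_simple[OF s, of v] by (simp add: realizations_def)
  have e: "set_uprod e \<subseteq> {1..n}" "proper_uprod e" if "e \<in># edges G" for e
    using s v that by (simp_all add: simple_graph_def)
  show "neighbours G v \<subseteq> {1..n}"
  proof
    fix w
    assume "w \<in> neighbours G v"
    then show "w \<in> {1..n}"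
      using e(1)[of "Upair v w"] by (simp add: neighbours_def adjacent_def)
  qed
  show "v \<notin> neighbours G v"
    using e(2)[of "Upair v v"] by (auto simp: neighbours_def adjacent_def)
  show "w \<in> neighbours G v \<longleftrightarrow> v \<in> neighbours G w"
    using adjacent_commute[of G v w] by (simp add: neighbours_def)
qed

text \<open>The half-edges \<open>\<sigma> x\<close> and \<open>\<sigma>' x\<close> lie at the same
  vertex, and the partners of both under \<sigma> lie at the vertex of \<open>x\<close>. As there
  are no parallel edges, they coincide.\<close>

lemma lists_of_pairing_inj:
  "inj_on (lists_of_pairing n d) (simple_pairings n d)"
proof (rule inj_onI)
  fix \<sigma> \<sigma>'
  assume \<sigma>: "\<sigma> \<in> simple_pairings n d" and \<sigma>': "\<sigma>' \<in> simple_pairings n d"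
    and eq: "lists_of_pairing n d \<sigma> = lists_of_pairing n d \<sigma>'"
  let ?X = "half_edges n d"
  have f: "fst (\<sigma> x) = fst (\<sigma>' x)" if xX: "x \<in> ?X" for x
  proof -
    obtain v i where x: "x = (v, i)" "v \<in> {1..n}" "i < d v"
      using xX by (cases x) (auto simp: half_edges_iff)
    have "lists_of_pairing n d \<sigma> v ! i = lists_of_pairing n d \<sigma>' v ! i"
      by (simp only: eq)
    then show ?thesis
      using x by (simp add: lists_of_pairing_def)
  qed
  have "\<sigma> x = \<sigma>' x" if x: "x \<in> ?X" for x
  proof (rule simple_pairingsD(6)[OF \<sigma>])
    show "\<sigma> x \<in> ?X" "\<sigma>' x \<in> ?X" "fst (\<sigma> x) = fst (\<sigma>' x)"
      using simple_pairingsD(3)[OF \<sigma> x] simple_pairingsD(3)[OF \<sigma>' x] f[OF x] by auto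
    then show "fst (\<sigma> (\<sigma> x)) = fst (\<sigma> (\<sigma>' x))"
      using simple_pairingsD(4)[OF \<sigma> x] simple_pairingsD(4)[OF \<sigma>' x] f[of "\<sigma>' x"] by simp
  qed
  then show "\<sigma> = \<sigma>'"
    using simple_pairingsD(2)[OF \<sigma>] simple_pairingsD(2)[OF \<sigma>'] by (metis ext)
qed

lemma lists_of_pairing_mem:
  assumes \<sigma>: "\<sigma> \<in> simple_pairings n d"
  shows "lists_of_pairing n d \<sigma> \<in> adjacency_lists n d (pairing_graph n d \<sigma>)"
proof -
  have "distinct (map (\<lambda>i. fst (\<sigma> (v, i))) [0..<d v]) \<and>
      set (map (\<lambda>i. fst (\<sigma> (v, i))) [0..<d v]) \<subseteq> neighbours (pairing_graph n d \<sigma>) v"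
    if v: "v \<in> {1..n}" for v
  proof
    have "inj_on (\<lambda>i. fst (\<sigma> (v, i))) {0..<d v}"
    proof (rule inj_onI)
      fix i j
      assume "i \<in> {0..<d v}" "j \<in> {0..<d v}" "fst (\<sigma> (v, i)) = fst (\<sigma> (v, j))"
      then show "i = j"
        using simple_pairingsD(6)[OF \<sigma>, of "(v, i)" "(v, j)"] v by (simp add: half_edges_iff)
    qed
    then show "distinct (map (\<lambda>i. fst (\<sigma> (v, i))) [0..<d v])"
      by (simp add: distinct_map)
    show "set (map (\<lambda>i. fst (\<sigma> (v, i))) [0..<d v]) \<subseteq> neighbours (pairing_graph n d \<sigma>) v"
    proof
      fix w
      assume "w \<in> set (map (\<lambda>i. fst (\<sigma> (v, i))) [0..<d v])"
      then obtain i where "i < d v" "w = fst (\<sigma> (v, i))"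
        by auto
      then show "w \<in> neighbours (pairing_graph n d \<sigma>) v"
        unfolding neighbours_def adjacent_pairing_graph[OF \<sigma>]
        using v by (auto simp: half_edges_iff intro!: bexI[of _ "(v, i)"])
    qed
  qed
  then show ?thesis
    by (simp add: adjacency_lists_def lists_of_pairing_def)
qed

text \<open>If \<open>w\<close> is entry \<open>i\<close> of the list at \<open>v\<close>, then
  \<open>(v, i)\<close> has to be matched with the half-edge of \<open>w\<close> whose entry is
  \<open>v\<close>; its index is \<open>idx w v\<close>, which exists because adjacency is
  symmetric.\<close>

lemma lists_of_pairing_surj:
  assumes G: "G \<in> realizations n d" and \<phi>: "\<phi> \<in> adjacency_lists n d G"
  shows "\<exists>\<sigma>\<in>simple_pairings n d. pairing_graph n d \<sigma> = G \<and> lists_of_pairing n d \<sigma> = \<phi>"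
proof -
  let ?X = "half_edges n d" and ?V = "{1..n}"
  note r = realizationsD[OF G]
  have \<phi>v: "length (\<phi> v) = d v" "distinct (\<phi> v)" "set (\<phi> v) = neighbours G v" if v: "v \<in> ?V" for v
  proof -
    have *: "length (\<phi> v) = d v" "distinct (\<phi> v)" "set (\<phi> v) \<subseteq> neighbours G v"
      using \<phi> PiE_mem[OF _ v] unfolding adjacency_lists_def by blast+
    show "length (\<phi> v) = d v" "distinct (\<phi> v)"
      using * by auto
    show "set (\<phi> v) = neighbours G v"
      using * r(3,4)[of v] v distinct_card[OF *(2)] finite_subset[of "neighbours G v" ?V]
      by (intro card_subset_eq) simp_all
  qed
  define idx where "idx w v = (THE j. j < d w \<and> \<phi> w ! j = v)" for w v
  have idx: "idx w v < d w \<and> \<phi> w ! idx w v = v" if w: "w \<in> ?V" and v: "v \<in> neighbours G w" for w v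
  proof -
    have "\<exists>!j. j < length (\<phi> w) \<and> \<phi> w ! j = v"
      using distinct_Ex1[of "\<phi> w" v] \<phi>v[OF w] v by simp
    then have "\<exists>!j. j < d w \<and> \<phi> w ! j = v"
      by (simp only: \<phi>v(1)[OF w])
    then show ?thesis
      unfolding idx_def by (rule theI')
  qed
  have idx_nth: "idx v (\<phi> v ! i) = i" if v: "v \<in> ?V" and i: "i < d v" for v i
    unfolding idx_def
  proof (rule the_equality)
    show "j = i" if "j < d v \<and> \<phi> v ! j = \<phi> v ! i" for j
      using that i \<phi>v[OF v] nth_eq_iff_index_eq by metis
  qed (use i in simp)
  define \<sigma> where "\<sigma> x = (if x \<in> ?X then (\<phi> (fst x) ! snd x, idx (\<phi> (fst x) ! snd x) (fst x)) else x)" for x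
  have nb: "\<phi> v ! i \<in> neighbours G v" "\<phi> v ! i \<in> ?V" "v \<in> neighbours G (\<phi> v ! i)"
    if v: "v \<in> ?V" and i: "i < d v" for v i
  proof -
    show 1: "\<phi> v ! i \<in> neighbours G v"
      using \<phi>v[OF v] i nth_mem by metis
    then show "\<phi> v ! i \<in> ?V" "v \<in> neighbours G (\<phi> v ! i)"
      using r(4)[of v] r(6)[of "\<phi> v ! i" v] by blast+
  qed
  have \<sigma>X: "\<sigma> (v, i) = (\<phi> v ! i, idx (\<phi> v ! i) v)" if "v \<in> ?V" "i < d v" for v i
    using that by (simp add: \<sigma>_def half_edges_iff)
  have SP: "\<sigma> \<in> simple_pairings n d"
  proof -
    have 1: "\<sigma> x \<in> ?X \<and> \<sigma> (\<sigma> x) = x \<and> fst (\<sigma> x) \<noteq> fst x" if x: "x \<in> ?X" for x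
    proof -
      obtain v i where vi: "x = (v, i)" "v \<in> ?V" "i < d v"
        using x by (cases x) (auto simp: half_edges_iff)
      note n = nb[OF vi(2,3)]
      note j = idx[OF n(2,3)]
      have "\<phi> v ! i \<noteq> v"
        using n(1) r(5)[of v] by auto
      moreover have "\<sigma> (\<phi> v ! i, idx (\<phi> v ! i) v) = (v, i)"
        using j by (simp add: \<sigma>X[OF n(2)] idx_nth[OF vi(2,3)])
      ultimately show ?thesis
        using n(2) j by (simp add: vi(1) \<sigma>X[OF vi(2,3)] half_edges_iff)
    qed
    have 2: "x = y" if xy: "x \<in> ?X" "y \<in> ?X" "fst x = fst y" "fst (\<sigma> x) = fst (\<sigma> y)" for x y
    proof -
      define v i j where "v = fst x" and "i = snd x" and "j = snd y"
      then have vi: "x = (v, i)" "y = (v, j)"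
        using xy(3) by (simp_all add: prod_eq_iff)
      then have vX: "v \<in> ?V" "i < d v" "j < d v"
        using xy(1,2) unfolding vi half_edges_iff by blast+
      have "\<phi> v ! i = \<phi> v ! j"
        using xy(4) unfolding vi \<sigma>X[OF vX(1,2)] \<sigma>X[OF vX(1,3)] fst_conv .
      then have "i = j"
        using idx_nth[OF vX(1,2)] idx_nth[OF vX(1,3)] by metis
      then show ?thesis
        unfolding vi by (rule arg_cong)
    qed
    have 3: "\<sigma> x = x" if "x \<notin> ?X" for x
      using that by (simp add: \<sigma>_def)
    have 4: "\<sigma> x \<noteq> x" if "x \<in> ?X" for x
      using 1[OF that] by metis
    have "pairing ?X \<sigma>"
      unfolding pairing_def using 1 4 by (intro ballI conjI) blast+
    moreover have "\<forall>x. x \<notin> ?X \<longrightarrow> \<sigma> x = x"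
      using 3 by blast
    moreover have "\<forall>x\<in>?X. fst (\<sigma> x) \<noteq> fst x"
      using 1 by blast
    moreover have "\<forall>x\<in>?X. \<forall>y\<in>?X. fst x = fst y \<longrightarrow> fst (\<sigma> x) = fst (\<sigma> y) \<longrightarrow> x = y"
      by (intro ballI impI) (rule 2)
    ultimately show ?thesis
      unfolding simple_pairings_def mem_Collect_eq by (intro conjI)
  qed
  have lists: "lists_of_pairing n d \<sigma> = \<phi>"
  proof
    fix v
    show "lists_of_pairing n d \<sigma> v = \<phi> v"
    proof (cases "v \<in> ?V")
      case True
      then show ?thesis
        using \<phi>v[OF True] by (auto simp: lists_of_pairing_def \<sigma>X intro!: nth_equalityI)
    next
      case False
      then have "\<phi> v = undefined"
        using \<phi> unfolding adjacency_lists_def by (rule PiE_arb[rotated])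
      then show ?thesis
        unfolding lists_of_pairing_def restrict_def if_not_P[OF False] by (rule sym)
    qed
  qed
  have adj: "adjacent (pairing_graph n d \<sigma>) u w \<longleftrightarrow> adjacent G u w" for u w
  proof
    assume "adjacent (pairing_graph n d \<sigma>) u w"
    then obtain x where x: "x \<in> ?X" "fst x = u" "fst (\<sigma> x) = w"
      unfolding adjacent_pairing_graph[OF SP] by blast
    then obtain i where "x = (u, i)" "u \<in> ?V" "i < d u"
      by (cases x) (auto simp: half_edges_iff)
    then show "adjacent G u w"
      using nb(1)[of u i] x(3) by (simp add: \<sigma>X neighbours_def)
  next
    assume "adjacent G u w"
    then have w: "w \<in> neighbours G u" and "u \<in> neighbours G w"
      using r(6)[of w u] by (auto simp: neighbours_def)
    then have u: "u \<in> ?V"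
      using r(4)[of w] by blast
    note j = idx[OF u w]
    then have "(u, idx u w) \<in> ?X" "fst (\<sigma> (u, idx u w)) = w"
      using u by (simp_all add: half_edges_iff \<sigma>X)
    then show "adjacent (pairing_graph n d \<sigma>) u w"
      unfolding adjacent_pairing_graph[OF SP] by (intro bexI[of _ "(u, idx u w)"]) auto
  qed
  have "pairing_graph n d \<sigma> = G"
  proof -
    have e: "edges (pairing_graph n d \<sigma>) = edges G"
    proof (rule multiset_eqI)
      fix e :: "nat uprod"
      obtain u w where e: "e = Upair u w"
        by (cases e)
      have c: "count (edges H) e = of_bool (adjacent H u w)" if "H \<in> realizations n d" for H
        using that by (auto simp: e realizations_def simple_graph_def adjacent_def not_in_iff)
      show "count (edges (pairing_graph n d \<sigma>)) e = count (edges G) e"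
        by (simp only: c[OF G] c[OF pairing_graph_realizes[OF SP]] adj)
    qed
    show ?thesis
      using e r(2) by (cases G) (simp add: pairing_graph_def)
  qed
  then show ?thesis
    using SP lists by blast
qed

text \<open>Here \<open>\<Prod>{1..d v}\<close> is the factorial of \<open>d v\<close>. As the count
  is the same for every \<open>G\<close>, uniform simple pairings project to uniform
  realizations.\<close>

lemma fibre_pairing_graph:
  assumes G: "G \<in> realizations n d"
  shows "finite {\<sigma> \<in> simple_pairings n d. pairing_graph n d \<sigma> = G}"
    and "card {\<sigma> \<in> simple_pairings n d. pairing_graph n d \<sigma> = G} = (\<Prod>v\<in>{1..n}. \<Prod>{1..d v})"
proof -
  let ?F = "{\<sigma> \<in> simple_pairings n d. pairing_graph n d \<sigma> = G}"
  have "bij_betw (lists_of_pairing n d) ?F (adjacency_lists n d G)"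
    unfolding bij_betw_def
  proof
    show "inj_on (lists_of_pairing n d) ?F"
      by (rule inj_on_subset[OF lists_of_pairing_inj]) blast
    show "lists_of_pairing n d ` ?F = adjacency_lists n d G"
    proof (intro equalityI subsetI)
      fix \<phi>
      assume "\<phi> \<in> lists_of_pairing n d ` ?F"
      then show "\<phi> \<in> adjacency_lists n d G"
        using lists_of_pairing_mem by blast
    next
      fix \<phi>
      assume "\<phi> \<in> adjacency_lists n d G"
      from lists_of_pairing_surj[OF G this] show "\<phi> \<in> lists_of_pairing n d ` ?F"
        by blast
    qed
  qed
  note bij = this
  have fin: "finite (neighbours G v)" for v
    using realizationsD(4)[OF G] finite_subset by blast
  have c: "card {xs. length xs = d v \<and> distinct xs \<and> set xs \<subseteq> neighbours G v} = \<Prod>{1..d v}"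
    if "v \<in> {1..n}" for v
    using card_lists_distinct_length_eq[OF fin, of "d v" v] realizationsD(3)[OF G that] by simp
  have "finite {xs. length xs = d v \<and> distinct xs \<and> set xs \<subseteq> neighbours G v}" for v
    by (rule finite_subset[OF _ finite_lists_length_eq[OF fin, of v "d v"]]) auto
  then have "finite (adjacency_lists n d G)"
    unfolding adjacency_lists_def by (intro finite_PiE) auto
  then show "finite ?F"
    using bij bij_betw_finite by blast
  have "card ?F = card (adjacency_lists n d G)"
    using bij by (rule bij_betw_same_card)
  also have "\<dots> = (\<Prod>v\<in>{1..n}. \<Prod>{1..d v})"
    unfolding adjacency_lists_def using c by (simp add: card_PiE)
  finally show "card ?F = (\<Prod>v\<in>{1..n}. \<Prod>{1..d v})" .
qed

section \<open>Probabilities of graphs as proportions of simple pairings\<close>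

lemma finite_simple_pairings: "finite (simple_pairings n d)"
proof -
  have "simple_pairings n d =
      (\<Union>G\<in>realizations n d. {\<sigma> \<in> simple_pairings n d. pairing_graph n d \<sigma> = G})"
    using pairing_graph_realizes by blast
  also have "finite \<dots>"
    using finite_realizations fibre_pairing_graph(1) by (rule finite_UN_I)
  finally show ?thesis .
qed

lemma card_pairings_over:
  assumes "Z \<subseteq> realizations n d"
  shows "card {\<sigma> \<in> simple_pairings n d. pairing_graph n d \<sigma> \<in> Z} =
    card Z * (\<Prod>v\<in>{1..n}. \<Prod>{1..d v})"
proof -
  let ?F = "\<lambda>G. {\<sigma> \<in> simple_pairings n d. pairing_graph n d \<sigma> = G}"
  have "{\<sigma> \<in> simple_pairings n d. pairing_graph n d \<sigma> \<in> Z} = (\<Union>G\<in>Z. ?F G)"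
    by blast
  moreover have "card (\<Union>G\<in>Z. ?F G) = (\<Sum>G\<in>Z. card (?F G))"
  proof (rule card_UN_disjoint)
    show "finite Z"
      using assms finite_realizations by (rule finite_subset)
    show "\<forall>G\<in>Z. finite (?F G)"
      using fibre_pairing_graph(1) assms by blast
  qed blast
  moreover have "(\<Sum>G\<in>Z. card (?F G)) = (\<Sum>G\<in>Z. \<Prod>v\<in>{1..n}. \<Prod>{1..d v})"
    using fibre_pairing_graph(2) assms by (intro sum.cong) auto
  ultimately show ?thesis
    by simp
qed

lemma card_simple_pairings:
  "card (simple_pairings n d) = card (realizations n d) * (\<Prod>v\<in>{1..n}. \<Prod>{1..d v})"
proof -
  have "{\<sigma> \<in> simple_pairings n d. pairing_graph n d \<sigma> \<in> realizations n d} = simple_pairings n d"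
    using pairing_graph_realizes by blast
  then show ?thesis
    using card_pairings_over[of "realizations n d" n d] by simp
qed

lemma card_simple_pairings_pos:
  assumes "realizations n d \<noteq> {}"
  shows "card (simple_pairings n d) > 0"
proof -
  have "(\<Prod>v\<in>{1..n}. \<Prod>{1..d v}) > 0"
    by (auto intro!: prod_pos)
  then show ?thesis
    using assms finite_realizations unfolding card_simple_pairings by (simp add: card_gt_0_iff)
qed

lemma prob_random_reduced_graph:
  assumes "realizations n d \<noteq> {}"
  shows "measure_pmf.prob (random_reduced_graph n d) {H. P H} * real (card (simple_pairings n d)) =
    real (card {\<sigma> \<in> simple_pairings n d. P (reduced_graph (pairing_graph n d \<sigma>))})"
proof -
  let ?R = "realizations n d" and ?c = "\<Prod>v\<in>{1..n}. \<Prod>{1..d v}"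
  let ?Z = "{G \<in> ?R. P (reduced_graph G)}"
  have "measure_pmf.prob (random_reduced_graph n d) {H. P H} = card ?Z / card ?R"
    using assms finite_realizations
    by (simp add: random_reduced_graph_def random_graph_def measure_pmf_of_set vimage_def Int_def conj_commute)
  moreover have "card ?R > 0"
    using assms finite_realizations by (simp add: card_gt_0_iff)
  moreover note card_simple_pairings[of n d]
  moreover have "card {\<sigma> \<in> simple_pairings n d. P (reduced_graph (pairing_graph n d \<sigma>))} = card ?Z * ?c"
  proof -
    have "{\<sigma> \<in> simple_pairings n d. pairing_graph n d \<sigma> \<in> ?Z} =
        {\<sigma> \<in> simple_pairings n d. P (reduced_graph (pairing_graph n d \<sigma>))}"
      using pairing_graph_realizes by blast
    then show ?thesis
      using card_pairings_over[of ?Z n d] by simp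
  qed
  ultimately show ?thesis
    by simp
qed

section \<open>Switchings of simple pairings\<close>

text \<open>This exchanges the names of \<open>k\<close> and \<open>y\<close>: two edges swap ends,
  and nothing changes if \<open>k\<close> and \<open>y\<close> are matched with each other. As a
  conjugation it can be undone for every function \<sigma>, without assumptions.\<close>

definition switch :: "'x \<Rightarrow> 'x \<Rightarrow> ('x \<Rightarrow> 'x) \<Rightarrow> 'x \<Rightarrow> 'x" where
  "switch k y \<sigma> = Transposition.transpose k y \<circ> \<sigma> \<circ> Transposition.transpose k y"

lemma switch_switch: "switch y k (switch k y \<sigma>) = \<sigma>"
  by (auto simp: switch_def fun_eq_iff transpose_commute[of y k])

lemma pairing_switch:
  assumes "pairing X \<sigma>" "k \<in> X" "y \<in> X"
  shows "pairing X (switch k y \<sigma>)"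
  unfolding pairing_def
proof
  fix x
  let ?t = "Transposition.transpose k y"
  have t: "?t z \<in> X \<longleftrightarrow> z \<in> X" for z
    using assms(2,3) by (simp add: Transposition.transpose_def)
  assume "x \<in> X"
  then have "?t x \<in> X"
    using t by simp
  then have "\<sigma> (?t x) \<in> X" "\<sigma> (?t x) \<noteq> ?t x" "\<sigma> (\<sigma> (?t x)) = ?t x"
    using assms(1) by (auto simp: pairing_def)
  then show "switch k y \<sigma> x \<in> X \<and> switch k y \<sigma> x \<noteq> x \<and> switch k y \<sigma> (switch k y \<sigma> x) = x"
    using t[of "\<sigma> (?t x)"] by (auto simp: switch_def transpose_eq_iff)
qed

text \<open>The new edges join \<open>fst k\<close> to \<open>fst (\<sigma> y)\<close> and
  \<open>fst y\<close> to \<open>fst (\<sigma> k)\<close>; the two assumptions say that each pair is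
  distinct and not yet adjacent. The new edges are not parallel to each other either:
  \<open>fst k = fst y\<close> would make \<open>fst y\<close> a neighbour of
  \<open>fst (\<sigma> k)\<close>, and \<open>fst k\<close> differs from
  \<open>fst (\<sigma> k)\<close>.\<close>

lemma switch_simple:
  assumes \<sigma>: "\<sigma> \<in> simple_pairings n d" and k: "k \<in> half_edges n d" and y: "y \<in> half_edges n d"
    and 1: "fst y \<notin> insert (fst (\<sigma> k)) (neighbours (pairing_graph n d \<sigma>) (fst (\<sigma> k)))"
    and 2: "fst (\<sigma> y) \<notin> insert (fst k) (neighbours (pairing_graph n d \<sigma>) (fst k))"
  shows "switch k y \<sigma> \<in> simple_pairings n d"
proof -
  let ?X = "half_edges n d" and ?s = "switch k y \<sigma>"
  let ?nb = "\<lambda>v w. w \<in> neighbours (pairing_graph n d \<sigma>) v"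
  have nb: "?nb (fst x) (fst (\<sigma> x))" if "x \<in> ?X" for x
    using that unfolding neighbours_def adjacent_pairing_graph[OF \<sigma>] by blast
  have nb_sym: "?nb v w \<longleftrightarrow> ?nb w v" for v w
    using adjacent_commute[of _ v w] by (simp add: neighbours_def)
  note inv = simple_pairingsD(4)[OF \<sigma>] and ne = simple_pairingsD(5)[OF \<sigma>]
    and mem = simple_pairingsD(3)[OF \<sigma>]
  let ?k = "\<sigma> k" and ?y = "\<sigma> y"
  have K: "?k \<in> ?X" "?y \<in> ?X" "\<sigma> ?k = k" "\<sigma> ?y = y"
    using k y mem inv by auto
  have nbk: "?nb (fst ?k) (fst k)" "?nb (fst k) (fst ?k)" "?nb (fst ?y) (fst y)" "?nb (fst y) (fst ?y)"
    using nb[OF k] nb[OF y] nb_sym by blast+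
  have n: "fst y \<noteq> fst ?k" "\<not> ?nb (fst ?k) (fst y)" "fst ?y \<noteq> fst k" "\<not> ?nb (fst k) (fst ?y)"
    "\<not> ?nb (fst y) (fst ?k)" "\<not> ?nb (fst ?y) (fst k)"
    using 1 2 nb_sym by blast+
  have ne': "fst ?k \<noteq> fst k" "fst ?y \<noteq> fst y"
    using ne k y by blast+
  have dist: "y \<noteq> ?k" "?y \<noteq> k" "?k \<noteq> k" "?y \<noteq> y" "k \<noteq> y" "?k \<noteq> ?y"
    using n nbk ne' by auto
  have sk: "?s k = ?y" "?s y = ?k" "?s ?k = y" "?s ?y = k"
    using dist K by (auto simp: switch_def Transposition.transpose_def)
  have so: "?s x = \<sigma> x" if x: "x \<in> ?X" "x \<notin> {k, y, ?k, ?y}" for x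
  proof -
    have "\<sigma> x \<noteq> k" "\<sigma> x \<noteq> y"
      using inv[OF x(1)] x(2) by auto
    then show ?thesis
      using x(2) by (simp add: switch_def Transposition.transpose_def)
  qed
  have out: "\<not> ?nb (fst x) (fst (?s x)) \<and> fst (?s x) \<noteq> fst x" if "x \<in> {k, y, ?k, ?y}" for x
    using that n sk by auto
  have "fst (?s x) \<noteq> fst x" if "x \<in> ?X" for x
    using out[of x] so[OF that] ne[OF that] by metis
  moreover have "x = z"
    if xz: "x \<in> ?X" "z \<in> ?X" "fst x = fst z" "fst (?s x) = fst (?s z)" for x z
  proof -
    consider "x \<in> {k, y, ?k, ?y}" "z \<in> {k, y, ?k, ?y}" | "x \<in> {k, y, ?k, ?y}" "z \<notin> {k, y, ?k, ?y}"
      | "x \<notin> {k, y, ?k, ?y}" "z \<in> {k, y, ?k, ?y}" | "x \<notin> {k, y, ?k, ?y}" "z \<notin> {k, y, ?k, ?y}"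
      by blast
    then show ?thesis
    proof cases
      case 1
      have "fst k \<noteq> fst y \<or> fst ?k \<noteq> fst ?y"
        using n nbk by metis
      then show ?thesis
        using 1 xz(3,4) n ne' nbk unfolding insert_iff empty_iff
        by (elim disjE FalseE) (simp_all add: sk)
    next
      case 2
      then show ?thesis
        using out[of x] so[OF xz(2)] nb[OF xz(2)] xz(3,4) by metis
    next
      case 3
      then show ?thesis
        using out[of z] so[OF xz(1)] nb[OF xz(1)] xz(3,4) by metis
    next
      case 4
      then show ?thesis
        using so[OF xz(1)] so[OF xz(2)] simple_pairingsD(6)[OF \<sigma> xz(1-3)] xz(4) by simp
    qed
  qed
  moreover have "?s x = x" if "x \<notin> ?X" for x
  proof -
    have "x \<noteq> k" "x \<noteq> y"
      using that k y by auto
    then show ?thesis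
      using simple_pairingsD(2)[OF \<sigma> that] by (simp add: switch_def)
  qed
  moreover have "pairing ?X ?s"
    using simple_pairingsD(1)[OF \<sigma>] k y by (rule pairing_switch)
  ultimately show ?thesis
    unfolding simple_pairings_def mem_Collect_eq by blast
qed

section \<open>Few switches destroy simplicity\<close>

lemma card_half_edges_in:
  assumes "N \<subseteq> {1..n}"
  shows "card {x \<in> half_edges n d. fst x \<in> N} = (\<Sum>w\<in>N. d w)"
proof -
  have fin: "finite N"
    using assms finite_subset by blast
  have "{x \<in> half_edges n d. fst x \<in> N} = (SIGMA v:N. {..<d v})"
    using assms by (auto simp: half_edges_def)
  then show ?thesis
    using fin by simp
qed

text \<open>By \<open>switch_simple\<close> a bad \<open>y\<close> lies at the closed neighbourhood
  of \<open>fst (\<sigma> k)\<close>, or its partner lies at that of \<open>fst k\<close>; \<sigma>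
  itself turns the second count into one of the first kind. \<open>L\<close> bounds the degree sum
  of any vertex set as small as a closed neighbourhood. The predicate \<open>P\<close> serves to
  restrict the count to half-edges at vertices of degree other than two.\<close>

lemma card_bad_switches:
  assumes \<sigma>: "\<sigma> \<in> simple_pairings n d" and k: "k \<in> half_edges n d"
    and L: "\<And>N. N \<subseteq> {1..n} \<Longrightarrow> (\<exists>v\<in>{1..n}. card N \<le> d v + 1) \<Longrightarrow> real (\<Sum>w\<in>N. d w) \<le> L"
  shows "real (card {y \<in> half_edges n d. P y \<and> switch k y \<sigma> \<notin> simple_pairings n d}) \<le> 2 * L"
proof -
  let ?X = "half_edges n d" and ?N = "\<lambda>v. insert v (neighbours (pairing_graph n d \<sigma>) v)"
  note r = realizationsD[OF pairing_graph_realizes[OF \<sigma>]]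
  have L': "real (\<Sum>w\<in>?N v. d w) \<le> L \<and> ?N v \<subseteq> {1..n}" if v: "v \<in> {1..n}" for v
  proof
    show sub: "?N v \<subseteq> {1..n}"
      using v r(4)[of v] by simp
    have "card (?N v) \<le> d v + 1"
      using r(3)[OF v] finite_subset[OF r(4)[of v]] by (simp add: card_insert_if)
    then show "real (\<Sum>w\<in>?N v. d w) \<le> L"
      using L[OF sub] v by blast
  qed
  have fk: "fst k \<in> {1..n}" "fst (\<sigma> k) \<in> {1..n}"
    using k simple_pairingsD(3)[OF \<sigma> k] by (auto simp: half_edges_def)
  let ?A = "{y \<in> ?X. fst y \<in> ?N (fst (\<sigma> k))}" and ?B = "{y \<in> ?X. fst (\<sigma> y) \<in> ?N (fst k)}"
  have "{y \<in> ?X. P y \<and> switch k y \<sigma> \<notin> simple_pairings n d} \<subseteq> ?A \<union> ?B"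
    using switch_simple[OF \<sigma> k] by blast
  then have "card {y \<in> ?X. P y \<and> switch k y \<sigma> \<notin> simple_pairings n d} \<le> card (?A \<union> ?B)"
    using finite_half_edges by (intro card_mono) auto
  also have "\<dots> \<le> card ?A + card ?B"
    by (rule card_Un_le)
  also have "card ?B = card {y \<in> ?X. fst y \<in> ?N (fst k)}"
  proof (rule bij_betw_same_card[of \<sigma>], rule bij_betw_byWitness[where f' = \<sigma>])
    show "\<forall>a\<in>?B. \<sigma> (\<sigma> a) = a" "\<forall>a\<in>{y \<in> ?X. fst y \<in> ?N (fst k)}. \<sigma> (\<sigma> a) = a"
      "\<sigma> ` ?B \<subseteq> {y \<in> ?X. fst y \<in> ?N (fst k)}" "\<sigma> ` {y \<in> ?X. fst y \<in> ?N (fst k)} \<subseteq> ?B"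
      using simple_pairingsD(3,4)[OF \<sigma>] by auto
  qed
  finally have "card {y \<in> ?X. P y \<and> switch k y \<sigma> \<notin> simple_pairings n d} \<le>
      card ?A + card {y \<in> ?X. fst y \<in> ?N (fst k)}" .
  moreover have "card ?A = (\<Sum>w\<in>?N (fst (\<sigma> k)). d w)" "card {y \<in> ?X. fst y \<in> ?N (fst k)} = (\<Sum>w\<in>?N (fst k). d w)"
    using L'[OF fk(1)] L'[OF fk(2)] by (simp_all only: card_half_edges_in)
  ultimately show ?thesis
    using L'[OF fk(1)] L'[OF fk(2)] by linarith
qed

section \<open>Degree sums of a sorted sequence\<close>

locale sorted_sequence =
  fixes n :: nat and d \<pi> :: "nat \<Rightarrow> nat"
  assumes n: "n \<ge> 1" and pos: "\<And>v. v \<in> {1..n} \<Longrightarrow> d v > 0"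
    and sorting: "sorting_permutation n d \<pi>"
begin

definition heavy :: "nat set" where
  "heavy = \<pi> ` {j_seq n d \<pi>..n}"

lemma perm: "\<pi> permutes {1..n}"
  using sorting by (simp add: sorting_permutation_def)

text \<open>By minimality the index before \<open>j_seq\<close> is not in the set that defines it,
  also when the default value \<open>n\<close> is attained. For \<open>j_seq = 1\<close> the sum is
  empty.\<close>

lemma j_seq: "j_seq n d \<pi> \<in> {1..n}"
  and sum_before_j_seq: "(\<Sum>i\<in>{1..<j_seq n d \<pi>}. int (d (\<pi> i)) * (int (d (\<pi> i)) - 2)) \<le> 0"
proof -
  let ?f = "\<lambda>j. (\<Sum>i=1..j. int (d (\<pi> i)) * (int (d (\<pi> i)) - 2))"
  let ?J = "{j \<in> {1..n}. ?f j > 0} \<union> {n}"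
  have J: "finite ?J" "?J \<noteq> {}"
    by auto
  have j: "j_seq n d \<pi> = Min ?J"
    by (simp add: j_seq_def)
  have "?J \<subseteq> {1..n}"
    using n by auto
  then show jn: "j_seq n d \<pi> \<in> {1..n}"
    unfolding j using Min_in[OF J] by blast
  show "(\<Sum>i\<in>{1..<j_seq n d \<pi>}. int (d (\<pi> i)) * (int (d (\<pi> i)) - 2)) \<le> 0"
  proof (cases "j_seq n d \<pi> = 1")
    case False
    define i where "i = j_seq n d \<pi> - 1"
    have i: "i \<in> {1..n}" "i < j_seq n d \<pi>" "{1..<j_seq n d \<pi>} = {1..i}"
      using False jn by (auto simp: i_def)
    have "i \<notin> ?J"
      using i(2) Min_le[OF J(1), of i] unfolding j by linarith
    then have "?f i \<le> 0"
      using i(1) by auto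
    then show ?thesis
      by (simp only: i(3))
  qed simp
qed

lemma heavy_subset: "heavy \<subseteq> {1..n}"
  using j_seq permutes_image[OF perm] by (auto simp: heavy_def)

lemma sum_heavy: "(\<Sum>w\<in>heavy. d w) = R_seq n d \<pi>"
  unfolding heavy_def R_seq_def using permutes_inj[OF perm]
  by (subst sum.reindex) (auto intro: inj_on_subset)

lemma not_heavy: "{1..n} - heavy = \<pi> ` {1..<j_seq n d \<pi>}"
proof -
  have "{1..n} - heavy = \<pi> ` {1..n} - \<pi> ` {j_seq n d \<pi>..n}"
    unfolding heavy_def permutes_image[OF perm] ..
  also have "\<dots> = \<pi> ` ({1..n} - {j_seq n d \<pi>..n})"
    using permutes_inj[OF perm] by (rule image_set_diff[symmetric])
  also have "{1..n} - {j_seq n d \<pi>..n} = {1..<j_seq n d \<pi>}"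
    using j_seq by auto
  finally show ?thesis .
qed

lemma sum_not_heavy: "(\<Sum>w\<in>{1..n} - heavy. real (d w) * (real (d w) - 2)) \<le> 0"
proof -
  have "(\<Sum>w\<in>{1..n} - heavy. real (d w) * (real (d w) - 2)) =
      (\<Sum>i\<in>{1..<j_seq n d \<pi>}. real (d (\<pi> i)) * (real (d (\<pi> i)) - 2))"
    unfolding not_heavy using permutes_inj[OF perm]
    by (subst sum.reindex) (auto intro: inj_on_subset)
  also have "\<dots> = of_int (\<Sum>i\<in>{1..<j_seq n d \<pi>}. int (d (\<pi> i)) * (int (d (\<pi> i)) - 2))"
    by simp
  also have "\<dots> \<le> 0"
    using sum_before_j_seq by linarith
  finally show ?thesis .
qed

text \<open>The largest degree is a summand of \<open>R_seq\<close>, as the default in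
  \<open>j_seq\<close> ensures \<open>j_seq <= n\<close>.\<close>

lemma degree_le_R: "v \<in> {1..n} \<Longrightarrow> d v \<le> R_seq n d \<pi>"
proof -
  assume v: "v \<in> {1..n}"
  then obtain i where i: "i \<in> {1..n}" "v = \<pi> i"
    using permutes_image[OF perm] by blast
  have "d (\<pi> i) \<le> d (\<pi> n)"
    using sorting i(1) n by (auto simp: sorting_permutation_def)
  also have "\<dots> \<le> R_seq n d \<pi>"
    unfolding R_seq_def using j_seq by (intro member_le_sum) auto
  finally show ?thesis
    by (simp add: i(2))
qed

lemma R_pos: "R_seq n d \<pi> \<ge> 1"
  using degree_le_R[of 1] pos[of 1] n by simp

text \<open>
  \<open>x \<le> \<theta> * x\<^sup>2 + 1 / (4 * \<theta>)\<close> trades the at most \<open>R + 1\<close> summands against the sum of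
  \<open>x\<^sup>2\<close> over the vertices outside \<open>heavy\<close>, which is at most \<open>2 * M_seq n d\<close>.
\<close>

lemma sum_degrees_le:
  assumes N: "N \<subseteq> {1..n}" and c: "\<exists>v\<in>{1..n}. card N \<le> d v + 1" and \<theta>: "\<theta> > 0"
  defines "R \<equiv> real (R_seq n d \<pi>)" and "M \<equiv> real (M_seq n d)"
  shows "real (\<Sum>w\<in>N. d w) \<le> 5 * R + 2 * \<theta> * M + R / (2 * \<theta>)"
proof -
  have fin: "finite N"
    using N finite_subset by blast
  obtain v where "v \<in> {1..n}" "card N \<le> d v + 1"
    using c by blast
  then have cN: "real (card N) \<le> 2 * R"
    using degree_le_R[of v] R_pos unfolding R_def by linarith
  \<comment> \<open>Vertices of degree two contribute 0 to the sum of \<open>d * (d - 2)\<close> and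
    drop out, so the squares over \<open>?U\<close> can be compared with \<open>M\<close>, which
    does not count these vertices either.\<close>
  let ?U = "{w \<in> {1..n} - heavy. d w \<noteq> 2}"
  have sq: "(\<Sum>w\<in>?U. real (d w) * real (d w)) \<le> 2 * M"
  proof -
    have "(\<Sum>w\<in>?U. real (d w) * (real (d w) - 2)) = (\<Sum>w\<in>{1..n} - heavy. real (d w) * (real (d w) - 2))"
      by (rule sum.mono_neutral_left) auto
    then have "(\<Sum>w\<in>?U. real (d w) * (real (d w) - 2)) \<le> 0"
      using sum_not_heavy by simp
    then have "(\<Sum>w\<in>?U. real (d w) * real (d w)) \<le> 2 * (\<Sum>w\<in>?U. real (d w))"
      by (simp add: right_diff_distrib sum_subtractf sum_distrib_left mult.commute)
    also have "(\<Sum>w\<in>?U. real (d w)) \<le> M"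
      unfolding M_def M_seq_def of_nat_sum by (rule sum_mono2) auto
    finally show ?thesis
      by simp
  qed
  have q: "x \<le> \<theta> * (x * x) + 1 / (4 * \<theta>)" for x :: real
  proof -
    have "0 \<le> (2 * \<theta> * x - 1)\<^sup>2 / (4 * \<theta>)"
      using \<theta> by simp
    also have "\<dots> = \<theta> * (x * x) + 1 / (4 * \<theta>) - x"
      using \<theta> by (simp add: power2_eq_square field_simps)
    finally show ?thesis
      by simp
  qed
  have "real (\<Sum>w\<in>N. d w) \<le> (\<Sum>w\<in>N \<inter> heavy. real (d w)) + (\<Sum>w\<in>N - heavy. real (d w))"
    using fin by (simp add: sum.Int_Diff[symmetric])
  also have "(\<Sum>w\<in>N \<inter> heavy. real (d w)) \<le> (\<Sum>w\<in>heavy. real (d w))"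
    by (rule sum_mono2) (use heavy_subset finite_subset in auto)
  also have "\<dots> = R"
    unfolding R_def sum_heavy[symmetric] by simp
  \<comment> \<open>The constant 2 pays for vertices of degree two, the inequality \<open>q\<close>
    for all others; both are allowed for at every vertex.\<close>
  also have "(\<Sum>w\<in>N - heavy. real (d w)) \<le>
      (\<Sum>w\<in>N - heavy. 2 + (if d w \<noteq> 2 then \<theta> * (real (d w) * real (d w)) else 0) + 1 / (4 * \<theta>))"
  proof (rule sum_mono)
    show "real (d w) \<le> 2 + (if d w \<noteq> 2 then \<theta> * (real (d w) * real (d w)) else 0) + 1 / (4 * \<theta>)" for w
      using q[of "real (d w)"] \<theta> by (cases "d w = 2") auto
  qed
  also have "\<dots> = real (card (N - heavy)) * (2 + 1 / (4 * \<theta>)) +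
      (\<Sum>w\<in>N - heavy. if d w \<noteq> 2 then \<theta> * (real (d w) * real (d w)) else 0)"
    by (simp add: sum.distrib algebra_simps)
  also have "real (card (N - heavy)) * (2 + 1 / (4 * \<theta>)) \<le> 2 * R * (2 + 1 / (4 * \<theta>))"
  proof (rule mult_right_mono)
    show "real (card (N - heavy)) \<le> 2 * R"
      using cN card_mono[OF fin, of "N - heavy"] by simp
  qed (use \<theta> in simp)
  also have "(\<Sum>w\<in>N - heavy. if d w \<noteq> 2 then \<theta> * (real (d w) * real (d w)) else 0) =
      (\<Sum>w\<in>{w \<in> N - heavy. d w \<noteq> 2}. \<theta> * (real (d w) * real (d w)))"
    using fin by (intro sum.inter_filter[symmetric]) simp
  also have "\<dots> \<le> (\<Sum>w\<in>?U. \<theta> * (real (d w) * real (d w)))"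
    by (rule sum_mono2) (use N \<theta> in auto)
  also have "\<dots> \<le> \<theta> * (2 * M)"
    unfolding sum_distrib_left[symmetric] using sq \<theta> by (intro mult_left_mono) auto
  finally have "real (\<Sum>w\<in>N. d w) \<le> R + (2 * R * (2 + 1 / (4 * \<theta>)) + \<theta> * (2 * M))"
    by simp
  also have "\<dots> = 5 * R + 2 * \<theta> * M + R / (2 * \<theta>)"
    using \<theta> by (simp add: field_simps)
  finally show ?thesis .
qed

end

section \<open>Large components\<close>

context sorted_sequence
begin

section \<open>The half-edges at vertices of degree other than two\<close>

definition degree_two :: "nat list" where
  "degree_two = sorted_list_of_set {v \<in> {1..n}. d v = 2}"

definition core_half_edges :: "(nat \<times> nat) set" where
  "core_half_edges = {x \<in> half_edges n d. fst x \<notin> set degree_two}"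

lemma set_degree_two: "set degree_two = {v \<in> {1..n}. d v = 2}"
  by (simp add: degree_two_def)

lemma core_half_edges_eq: "core_half_edges = {x \<in> half_edges n d. fst x \<in> {v \<in> {1..n}. d v \<noteq> 2}}"
  unfolding core_half_edges_def set_degree_two by (auto simp: half_edges_def)

lemma card_core_in:
  assumes "K \<subseteq> {v \<in> {1..n}. d v \<noteq> 2}"
  shows "card {x \<in> core_half_edges. fst x \<in> K} = (\<Sum>w\<in>K. d w)"
proof -
  have "{x \<in> core_half_edges. fst x \<in> K} = {x \<in> half_edges n d. fst x \<in> K}"
    using assms unfolding core_half_edges_eq by blast
  moreover have "K \<subseteq> {1..n}"
    using assms by blast
  ultimately show ?thesis
    using card_half_edges_in[of K n d] by simp
qed

lemma card_core: "card core_half_edges = M_seq n d"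
proof -
  have "{x \<in> core_half_edges. fst x \<in> {v \<in> {1..n}. d v \<noteq> 2}} = core_half_edges"
    unfolding core_half_edges_eq by blast
  then show ?thesis
    using card_core_in[of "{v \<in> {1..n}. d v \<noteq> 2}"] by (simp add: M_seq_def)
qed

lemma card_core_at:
  "card {x \<in> core_half_edges. fst x = w} = (if w \<in> {1..n} \<and> d w \<noteq> 2 then d w else 0)"
proof (cases "w \<in> {1..n} \<and> d w \<noteq> 2")
  case True
  then show ?thesis
    using card_core_in[of "{w}"] by simp
next
  case False
  then have "{x \<in> core_half_edges. fst x = w} = {}"
    unfolding core_half_edges_eq by blast
  then show ?thesis
    using False by (simp only: card.empty if_False)
qed

lemma core_vertices: "fst ` core_half_edges = {v \<in> {1..n}. d v \<noteq> 2}"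
proof (intro equalityI subsetI)
  fix v
  assume v: "v \<in> {v \<in> {1..n}. d v \<noteq> 2}"
  then have "(v, 0) \<in> core_half_edges"
    using pos[of v] by (simp add: core_half_edges_eq half_edges_iff)
  then show "v \<in> fst ` core_half_edges"
    by force
qed (auto simp: core_half_edges_eq)

lemma half_edges_at_degree_two:
  assumes "z \<in> set degree_two"
  shows "{x \<in> half_edges n d. fst x = z} = {(z, 0), (z, 1)}"
proof -
  have "z \<in> {1..n}" "d z = 2"
    using assms by (simp_all add: set_degree_two)
  then have "{x \<in> half_edges n d. fst x = z} = Pair z ` {..<2}"
    using half_edges_at by metis
  also have "{..<2} = {0, 1::nat}"
    by auto
  finally show ?thesis
    by simp
qed

lemma distinct_degree_two: "distinct degree_two"
  by (simp add: degree_two_def)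

text \<open>By \<open>closed_splice_all\<close> a closed set of the spliced pairing becomes closed
  for \<sigma> after a change among vertices of degree two only, and a closed set cannot be left
  along edges.\<close>

lemma reaches_core_closed:
  assumes \<sigma>: "\<sigma> \<in> simple_pairings n d"
    and cl: "\<forall>x\<in>core_half_edges. fst x \<in> A \<longrightarrow> fst (splice_all degree_two \<sigma> x) \<in> A"
    and v: "v \<in> A" "v \<in> {1..n}" "d v \<noteq> 2"
    and w: "(adjacent (pairing_graph n d \<sigma>))\<^sup>*\<^sup>* v w" "d w \<noteq> 2"
  shows "w \<in> A"
proof -
  let ?Z = "set degree_two"
  have "\<exists>A'. A' - ?Z = A - ?Z \<and> (\<forall>x\<in>half_edges n d. fst x \<in> A' \<longrightarrow> fst (\<sigma> x) \<in> A')"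
  proof (rule closed_splice_all)
    show "\<forall>x\<in>half_edges n d. fst x \<notin> ?Z \<longrightarrow> fst x \<in> A \<longrightarrow> fst (splice_all degree_two \<sigma> x) \<in> A"
      using cl unfolding core_half_edges_def by blast
  qed (use simple_pairingsD(1)[OF \<sigma>] distinct_degree_two half_edges_at_degree_two in auto)
  then obtain A' where A': "A' - ?Z = A - ?Z" "\<forall>x\<in>half_edges n d. fst x \<in> A' \<longrightarrow> fst (\<sigma> x) \<in> A'"
    by blast
  have "v \<notin> ?Z"
    using v by (simp add: set_degree_two)
  then have "v \<in> A'"
    using A'(1) v(1) by blast
  from w(1) have "w \<in> A'"
  proof (induction rule: rtranclp_induct)
    case base
    show ?case
      by fact
  next
    case (step y z)
    then show ?case
      using A'(2) unfolding adjacent_pairing_graph[OF \<sigma>] by blast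
  qed
  moreover have "w \<notin> ?Z"
    using w(2) by (simp add: set_degree_two)
  ultimately show ?thesis
    using A'(1) by blast
qed

section \<open>From a large component to a surviving exploration\<close>

definition large_component :: "real \<Rightarrow> nat mgraph \<Rightarrow> bool" where
  "large_component s H \<longleftrightarrow> (\<exists>C\<in>graph_components H. real (size (edges C)) \<ge> s)"

lemma large_component_core:
  assumes \<sigma>: "\<sigma> \<in> simple_pairings n d"
    and large: "large_component s (reduced_graph (pairing_graph n d \<sigma>))"
  shows "\<exists>K\<subseteq>{v \<in> {1..n}. d v \<noteq> 2}. 2 * s \<le> real (\<Sum>w\<in>K. d w) \<and>
    (\<forall>v\<in>K. \<forall>w\<in>K. (adjacent (pairing_graph n d \<sigma>))\<^sup>*\<^sup>* v w)"
proof -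
  let ?G = "pairing_graph n d \<sigma>"
  have G: "simple_graph ?G" "verts ?G = {1..n}" "\<And>v. v \<in> {1..n} \<Longrightarrow> mdegree ?G v = d v"
    using pairing_graph_realizes[OF \<sigma>] by (auto simp: realizations_def)
  obtain C where C: "C \<in> graph_components (reduced_graph ?G)" "s \<le> real (size (edges C))"
    using large by (auto simp: large_component_def)
  note c = component_of_reduced_graph[OF G(1) C(1)]
  have K: "verts C \<subseteq> {v \<in> {1..n}. d v \<noteq> 2}"
    using c(1) G(2,3) by auto
  have "(\<Sum>v\<in>verts C. mdegree ?G v) = (\<Sum>v\<in>verts C. d v)"
    using K G(3) by (intro sum.cong) auto
  then have "2 * s \<le> real (\<Sum>w\<in>verts C. d w)"
    using c(3) C(2) by linarith
  then show ?thesis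
    using K c(2) by blast
qed

lemma core_switching:
  assumes v: "v \<in> {1..n}"
    and L: "\<And>N. N \<subseteq> {1..n} \<Longrightarrow> (\<exists>v\<in>{1..n}. card N \<le> d v + 1) \<Longrightarrow> real (\<Sum>w\<in>N. d w) \<le> L"
  shows "switching core_half_edges (insert v heavy) (simple_pairings n d) (splice_all degree_two) switch (2 * L)"
proof unfold_locales
  show "finite core_half_edges"
    using finite_half_edges by (simp add: core_half_edges_def)
  show "finite (insert v heavy)"
    using heavy_subset finite_subset by blast
  show "finite (simple_pairings n d)"
    by (rule finite_simple_pairings)
  show "pairing core_half_edges (splice_all degree_two \<sigma>)" if "\<sigma> \<in> simple_pairings n d" for \<sigma>
    unfolding core_half_edges_def
    using simple_pairingsD(1)[OF that] distinct_degree_two half_edges_at_degree_two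
    by (rule pairing_splice_all)
  show "switch y k (switch k y \<sigma>) = \<sigma>" for y k :: "nat \<times> nat" and \<sigma>
    by (rule switch_switch)
  show "splice_all degree_two (switch k y \<sigma>) x =
      Transposition.transpose k y (splice_all degree_two \<sigma> (Transposition.transpose k y x))"
    if "k \<in> core_half_edges" "y \<in> core_half_edges" for k y x \<sigma>
  proof -
    have "splice_all degree_two (switch k y \<sigma>) =
        Transposition.transpose k y \<circ> splice_all degree_two \<sigma> \<circ> Transposition.transpose k y"
      unfolding switch_def
    proof (rule splice_all_conj)
      fix z
      assume "z \<in> set degree_two"
      then have "fst k \<noteq> z" "fst y \<noteq> z"
        using that by (auto simp: core_half_edges_def)
      then show "Transposition.transpose k y (z, 0) = (z, 0) \<and> Transposition.transpose k y (z, 1) = (z, 1)"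
        by (auto simp: Transposition.transpose_def)
    qed simp
    then show ?thesis
      by simp
  qed
  show "real (card {y \<in> core_half_edges. switch k y \<sigma> \<notin> simple_pairings n d}) \<le> 2 * L"
    if "\<sigma> \<in> simple_pairings n d" "k \<in> core_half_edges" for \<sigma> k
  proof -
    have "{y \<in> core_half_edges. switch k y \<sigma> \<notin> simple_pairings n d} =
        {y \<in> half_edges n d. fst y \<notin> set degree_two \<and> switch k y \<sigma> \<notin> simple_pairings n d}"
      by (auto simp: core_half_edges_def)
    then show ?thesis
      using card_bad_switches[OF that(1) _ L, of k "\<lambda>y. fst y \<notin> set degree_two"] that(2)
      by (simp add: core_half_edges_def)
  qed
qed

text \<open>If the exploration from \<open>insert v heavy\<close> were dead after \<open>T\<close>
  steps, a closed set with at most \<open>2 * T\<close> half-edges would contain \<open>K\<close>.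
  Starting from \<open>heavy\<close> as well makes the remaining sum of \<open>d * (d - 2)\<close>
  nonpositive. The start set has degree sum at most \<open>d v + R <= 2 * R\<close>, whence
  \<open>8 * R\<close> for \<open>4 * D\<close>.\<close>

lemma card_reaching_large:
  assumes v: "v \<in> {1..n}"
    and L: "\<And>N. N \<subseteq> {1..n} \<Longrightarrow> (\<exists>v\<in>{1..n}. card N \<le> d v + 1) \<Longrightarrow> real (\<Sum>w\<in>N. d w) \<le> L"
    and L0: "L \<ge> 0" and T: "2 * real T + 1 + 2 * L \<le> real (M_seq n d) / 2"
  shows "real (card {\<sigma> \<in> simple_pairings n d. \<exists>K\<subseteq>{v \<in> {1..n}. d v \<noteq> 2}. v \<in> K \<and>
      2 * real T < real (\<Sum>w\<in>K. d w) \<and> (\<forall>w\<in>K. (adjacent (pairing_graph n d \<sigma>))\<^sup>*\<^sup>* v w)}) *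
      (real T * (real T - 1)) \<le>
    2 * real (M_seq n d) * (8 * real (R_seq n d \<pi>) + 2 * L) * real (card (simple_pairings n d))"
    (is "real (card ?Bad) * _ \<le> _")
proof -
  interpret switching core_half_edges fst "insert v heavy" "simple_pairings n d"
    "splice_all degree_two" switch "2 * L"
    using v L by (rule core_switching)
  have deg: "deg w = (if w \<in> {1..n} \<and> d w \<noteq> 2 then d w else 0)" for w
    unfolding deg_def by (rule card_core_at)
  have "?Bad \<subseteq> survivors T"
  proof
    fix \<sigma>
    assume "\<sigma> \<in> ?Bad"
    then obtain K where \<sigma>: "\<sigma> \<in> simple_pairings n d" and K: "K \<subseteq> {v \<in> {1..n}. d v \<noteq> 2}" "v \<in> K"
      "2 * real T < real (\<Sum>w\<in>K. d w)" "\<forall>w\<in>K. (adjacent (pairing_graph n d \<sigma>))\<^sup>*\<^sup>* v w"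
      by blast
    have "alive (splice_all degree_two \<sigma>) T"
    proof (rule ccontr)
      assume "\<not> ?thesis"
      from reached_of_dead[OF pairing[OF \<sigma>] this] obtain A where A: "insert v heavy \<subseteq> A"
        "card {x \<in> core_half_edges. fst x \<in> A} \<le> 2 * T"
        "\<forall>x\<in>core_half_edges. fst x \<in> A \<longrightarrow> fst (splice_all degree_two \<sigma> x) \<in> A"
        by blast
      have "K \<subseteq> A"
      proof
        fix w
        assume w: "w \<in> K"
        show "w \<in> A"
          by (rule reaches_core_closed[OF \<sigma> A(3)]) (use A(1) K w in auto)
      qed
      then have "card {x \<in> core_half_edges. fst x \<in> K} \<le> card {x \<in> core_half_edges. fst x \<in> A}"
        using finite_X by (intro card_mono) auto
      then show False
        using A(2) K(3) by (simp only: card_core_in[OF K(1)])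
    qed
    then show "\<sigma> \<in> survivors T"
      using \<sigma> by (simp add: survivors_def)
  qed
  then have "card ?Bad \<le> card (survivors T)"
    using finite_survivors by (rule card_mono[rotated])
  then have "real (card ?Bad) * (real T * (real T - 1)) \<le> real (card (survivors T)) * (real T * (real T - 1))"
  proof (intro mult_right_mono)
    show "0 \<le> real T * (real T - 1)"
      by (cases T) auto
  qed simp
  also have "\<dots> \<le> 2 * real (card core_half_edges) *
      (4 * (\<Sum>w\<in>insert v heavy. real (deg w)) + 2 * L) * real (card (simple_pairings n d))"
  proof (rule card_survivors_le)
    show "deg w \<noteq> 2" for w
      by (simp add: deg)
    show "heavy \<subseteq> insert v heavy"
      by blast
    have "(\<Sum>w\<in>fst ` core_half_edges - heavy. real (deg w) * (real (deg w) - 2)) =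
        (\<Sum>w\<in>{1..n} - heavy. real (d w) * (real (d w) - 2))"
      unfolding core_vertices by (rule sum.mono_neutral_cong_left) (auto simp: deg)
    then show "(\<Sum>w\<in>fst ` core_half_edges - heavy. real (deg w) * (real (deg w) - 2)) \<le> 0"
      using sum_not_heavy by simp
    show "2 * real T + 1 + 2 * L \<le> real (card core_half_edges) / 2"
      using T by (simp add: card_core)
  qed (use L0 in simp)
  also have "\<dots> \<le> 2 * real (card core_half_edges) *
      (8 * real (R_seq n d \<pi>) + 2 * L) * real (card (simple_pairings n d))"
  proof (intro mult_right_mono mult_left_mono)
    have fin: "finite heavy"
      using heavy_subset finite_subset by blast
    have "(\<Sum>w\<in>insert v heavy. real (deg w)) \<le> real (d v) + (\<Sum>w\<in>heavy. real (d w))"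
    proof -
      have "(\<Sum>w\<in>insert v heavy. real (deg w)) \<le> (\<Sum>w\<in>insert v heavy. real (d w))"
        by (intro sum_mono) (simp add: deg)
      also have "\<dots> \<le> real (d v) + (\<Sum>w\<in>heavy. real (d w))"
        using fin by (simp add: sum.insert_if)
      finally show ?thesis .
    qed
    also have "(\<Sum>w\<in>heavy. real (d w)) = real (R_seq n d \<pi>)"
      unfolding sum_heavy[symmetric] by simp
    finally show "4 * (\<Sum>w\<in>insert v heavy. real (deg w)) + 2 * L \<le> 8 * real (R_seq n d \<pi>) + 2 * L"
      using degree_le_R[OF v] by simp
  qed auto
  finally show ?thesis
    by (simp only: card_core)
qed

text \<open>Double counting of pairs (\<sigma>, v) with weight \<open>d v\<close>: each bad \<sigma>
  has weight at least \<open>2 * s\<close> on its large component, while all start vertices together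
  weigh \<open>M_seq\<close>. Counting vertices without weights would fail for components with few
  vertices of large degree.\<close>

lemma card_large_component:
  assumes L: "\<And>N. N \<subseteq> {1..n} \<Longrightarrow> (\<exists>v\<in>{1..n}. card N \<le> d v + 1) \<Longrightarrow> real (\<Sum>w\<in>N. d w) \<le> L"
    and L0: "L \<ge> 0" and T: "2 * real T + 1 + 2 * L \<le> real (M_seq n d) / 2" and s: "real T < s"
  defines "Bad \<equiv> {\<sigma> \<in> simple_pairings n d. large_component s (reduced_graph (pairing_graph n d \<sigma>))}"
  shows "2 * s * real (card Bad) * (real T * (real T - 1)) \<le>
    real (M_seq n d) * (2 * real (M_seq n d) * (8 * real (R_seq n d \<pi>) + 2 * L) *
      real (card (simple_pairings n d)))"
proof -
  let ?V = "{v \<in> {1..n}. d v \<noteq> 2}" and ?TT = "real T * (real T - 1)"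
  let ?in = "\<lambda>\<sigma> v. \<exists>K\<subseteq>?V. v \<in> K \<and> 2 * real T < real (\<Sum>w\<in>K. d w) \<and>
    (\<forall>w\<in>K. (adjacent (pairing_graph n d \<sigma>))\<^sup>*\<^sup>* v w)"
  let ?c = "2 * real (M_seq n d) * (8 * real (R_seq n d \<pi>) + 2 * L) * real (card (simple_pairings n d))"
  have TT: "?TT \<ge> 0"
    by (cases T) auto
  have finB: "finite Bad"
    using finite_simple_pairings by (simp add: Bad_def)
  have "2 * s * real (card Bad) = (\<Sum>\<sigma>\<in>Bad. 2 * s)"
    by simp
  also have "\<dots> \<le> (\<Sum>\<sigma>\<in>Bad. \<Sum>v\<in>?V. real (d v) * of_bool (?in \<sigma> v))"
  proof (rule sum_mono)
    fix \<sigma>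
    assume "\<sigma> \<in> Bad"
    then have \<sigma>: "\<sigma> \<in> simple_pairings n d" "large_component s (reduced_graph (pairing_graph n d \<sigma>))"
      by (simp_all add: Bad_def)
    obtain K where K: "K \<subseteq> ?V" "2 * s \<le> real (\<Sum>w\<in>K. d w)"
      "\<forall>v\<in>K. \<forall>w\<in>K. (adjacent (pairing_graph n d \<sigma>))\<^sup>*\<^sup>* v w"
      using large_component_core[OF \<sigma>] by blast
    have "?in \<sigma> v" if "v \<in> K" for v
      using K s that by (intro exI[of _ K]) auto
    then have "(\<Sum>v\<in>K. real (d v)) = (\<Sum>v\<in>K. real (d v) * of_bool (?in \<sigma> v))"
      by (intro sum.cong) simp_all
    also have "\<dots> \<le> (\<Sum>v\<in>?V. real (d v) * of_bool (?in \<sigma> v))"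
      using K(1) by (intro sum_mono2) auto
    finally show "2 * s \<le> (\<Sum>v\<in>?V. real (d v) * of_bool (?in \<sigma> v))"
      using K(2) by simp
  qed
  also have "\<dots> = (\<Sum>v\<in>?V. real (d v) * real (card {\<sigma> \<in> Bad. ?in \<sigma> v}))"
    using finB by (subst sum.swap) (simp add: sum_distrib_left[symmetric] of_bool_def sum.If_cases Int_def)
  finally have "2 * s * real (card Bad) * ?TT \<le>
      (\<Sum>v\<in>?V. real (d v) * real (card {\<sigma> \<in> Bad. ?in \<sigma> v})) * ?TT"
    using TT by (rule mult_right_mono)
  also have "\<dots> = (\<Sum>v\<in>?V. real (d v) * (real (card {\<sigma> \<in> Bad. ?in \<sigma> v}) * ?TT))"
    by (simp only: sum_distrib_right mult.assoc)
  also have "\<dots> \<le> (\<Sum>v\<in>?V. real (d v) * ?c)"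
  proof (intro sum_mono mult_left_mono)
    fix v
    assume v: "v \<in> ?V"
    have "card {\<sigma> \<in> Bad. ?in \<sigma> v} \<le> card {\<sigma> \<in> simple_pairings n d. ?in \<sigma> v}"
      using finite_simple_pairings by (intro card_mono) (auto simp: Bad_def)
    then have "real (card {\<sigma> \<in> Bad. ?in \<sigma> v}) * ?TT \<le> real (card {\<sigma> \<in> simple_pairings n d. ?in \<sigma> v}) * ?TT"
      using TT by (intro mult_right_mono) auto
    also have "\<dots> \<le> ?c"
      using v by (intro card_reaching_large[OF _ L L0 T]) auto
    finally show "real (card {\<sigma> \<in> Bad. ?in \<sigma> v}) * ?TT \<le> ?c" .
  qed simp
  also have "\<dots> = real (M_seq n d) * ?c"
    by (simp add: M_seq_def sum_distrib_right)
  finally show ?thesis .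
qed

text \<open>The left side of the first bound on \<open>q\<close> is \<open>8 * R + 2 * L\<close> for
  the \<open>L\<close> of \<open>sum_degrees_le\<close>. The bounds 1 / 8 on \<gamma> and
  \<open>q\<close> keep each of \<open>2 * T\<close> and \<open>2 * L\<close> below
  \<open>M / 8\<close>, as the room for switchings requires. The result arises from a factor
  \<open>2 * \<gamma> * M\<close> by averaging and \<open>(\<gamma> * M / 4)^2\<close> by survival,
  against \<open>2 * q * M^3\<close>.\<close>

lemma prob_large_component:
  fixes \<theta> \<gamma> q :: real
  defines "M \<equiv> real (M_seq n d)" and "R \<equiv> real (R_seq n d \<pi>)"
  assumes feas: "realizations n d \<noteq> {}"
    and \<theta>: "\<theta> > 0" and \<gamma>: "0 < \<gamma>" "\<gamma> \<le> 1 / 8" and M: "\<gamma> * M \<ge> 8"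
    and q: "18 * R + 4 * \<theta> * M + R / \<theta> \<le> q * M" "q \<le> 1 / 8"
  shows "measure_pmf.prob (random_reduced_graph n d) {H. large_component (\<gamma> * M) H} \<le> 16 * q / \<gamma> ^ 3"
proof -
  define L where "L = 5 * R + 2 * \<theta> * M + R / (2 * \<theta>)"
  define T where "T = nat \<lfloor>\<gamma> * M / 2\<rfloor>"
  let ?N = "real (card (simple_pairings n d))" and ?s = "\<gamma> * M"
  let ?Bad = "{\<sigma> \<in> simple_pairings n d. large_component ?s (reduced_graph (pairing_graph n d \<sigma>))}"
  let ?P = "measure_pmf.prob (random_reduced_graph n d) {H. large_component ?s H}"
  have R0: "R \<ge> 0" and M0: "M > 0"
    using M \<gamma> by (auto simp: R_def M_def intro: Nat.gr0I)
  have L0: "L \<ge> 0"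
    using R0 M0 \<theta> by (simp add: L_def)
  have Lq: "8 * R + 2 * L \<le> q * M"
    using q(1) \<theta> by (simp add: L_def field_simps)
  have "real T \<le> \<gamma> * M / 2" "\<gamma> * M / 2 - 1 < real T"
    using M unfolding T_def by linarith+
  \<comment> \<open>Here \<open>\<gamma> * M\<close> being at least 8 is used: \<open>T - 1\<close>
    exceeds \<open>\<gamma> * M / 2 - 2\<close>, which is at least
    \<open>\<gamma> * M / 4\<close>.\<close>
  then have T: "real T \<le> \<gamma> * M / 2" "real T \<ge> \<gamma> * M / 4" "real T - 1 \<ge> \<gamma> * M / 4"
    using M by linarith+
  have \<gamma>M: "\<gamma> * M \<le> M / 8"
    using mult_right_mono[OF \<gamma>(2), of M] M0 by simp
  have "q * M \<le> M / 8"
    using mult_right_mono[OF q(2), of M] M0 by simp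
  then have "2 * L \<le> M / 8"
    using Lq R0 by linarith
  then have T': "2 * real T + 1 + 2 * L \<le> M / 2"
    using T(1) \<gamma>M M by linarith
  have "2 * ?s * real (card ?Bad) * (real T * (real T - 1)) \<le> M * (2 * M * (8 * R + 2 * L) * ?N)"
    unfolding M_def R_def
  proof (rule card_large_component)
    show "real (\<Sum>w\<in>N. d w) \<le> L" if "N \<subseteq> {1..n}" "\<exists>v\<in>{1..n}. card N \<le> d v + 1" for N
      using sum_degrees_le[OF that \<theta>] by (simp add: L_def M_def R_def)
    show "real T < \<gamma> * real (M_seq n d)"
      using T(1) M by (simp add: M_def)
  qed (use L0 T' in \<open>simp_all add: M_def\<close>)
  also have "\<dots> \<le> M * (2 * M * (q * M) * ?N)"
    using Lq M0 by (intro mult_left_mono mult_right_mono) auto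
  finally have 1: "2 * ?s * real (card ?Bad) * (real T * (real T - 1)) \<le> M * (2 * M * (q * M) * ?N)" .
  have "(\<gamma> * M / 4) * (\<gamma> * M / 4) \<le> real T * (real T - 1)"
    using T M by (intro mult_mono) auto
  then have "2 * ?s * real (card ?Bad) * ((\<gamma> * M / 4) * (\<gamma> * M / 4)) \<le>
      2 * ?s * real (card ?Bad) * (real T * (real T - 1))"
    using M by (intro mult_left_mono) auto
  with 1 have "2 * ?s * real (card ?Bad) * ((\<gamma> * M / 4) * (\<gamma> * M / 4)) \<le> M * (2 * M * (q * M) * ?N)"
    by linarith
  then have "(2 * M ^ 3) * (real (card ?Bad) * \<gamma> ^ 3) \<le> (2 * M ^ 3) * (16 * q * ?N)"
    by (simp add: power3_eq_cube algebra_simps)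
  then have "real (card ?Bad) * \<gamma> ^ 3 \<le> 16 * q * ?N"
    using M0 by (subst (asm) mult_le_cancel_left_pos) auto
  moreover have "real (card ?Bad) = ?P * ?N"
    using prob_random_reduced_graph[OF feas, of "large_component ?s"] by simp
  moreover have "?N > 0"
    using card_simple_pairings_pos[OF feas] by simp
  ultimately have "?N * (?P * \<gamma> ^ 3) \<le> ?N * (16 * q)"
    by (simp only: ac_simps)
  with \<open>?N > 0\<close> have "?P * \<gamma> ^ 3 \<le> 16 * q"
    by (rule mult_left_le_imp_le[rotated])
  then show ?thesis
    using \<gamma>(1) by (simp add: pos_le_divide_eq)
qed

end

section \<open>Choice of the constants\<close>

theorem theorem8:
  fixes lam :: "nat \<Rightarrow> nat" and \<delta> :: "nat \<Rightarrow> real" and \<gamma> :: real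
  assumes "filterlim lam at_top sequentially"
    and "\<delta> \<longlonglongrightarrow> 0"
    and "\<gamma> > 0"
  shows "\<forall>\<epsilon>>0. \<forall>\<^sub>F n in sequentially. \<forall>d \<pi>.
    feasible_sequence n d \<and> well_behaved lam n d \<and> sorting_permutation n d \<pi> \<and>
    real (R_seq n d \<pi>) \<le> \<delta> n * real (M_seq n d) \<longrightarrow>
    measure_pmf.prob (random_reduced_graph n d)
      {H. \<exists>C\<in>graph_components H. real (size (edges C)) \<ge> \<gamma> * real (M_seq n d)} < \<epsilon>"
proof (intro allI impI)
  fix \<epsilon> :: real
  assume \<epsilon>: "\<epsilon> > 0"
  \<comment> \<open>Lowering \<gamma> only enlarges the event, so the bound 1 / 8 may be
    imposed.\<close>
  define g where "g = min \<gamma> (1 / 8)"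
  have g: "g > 0" "g \<le> 1 / 8" "g \<le> \<gamma>"
    using assms(3) by (auto simp: g_def)
  \<comment> \<open>Any \<open>q < c\<close> gives \<open>16 * q / g ^ 3 < \<epsilon>\<close> and is
    admissible in \<open>prob_large_component\<close>.\<close>
  define c where "c = min (1 / 8) (\<epsilon> * g ^ 3 / 16)"
  have c: "c > 0" "c \<le> 1 / 8" "16 * c / g ^ 3 \<le> \<epsilon>"
  proof -
    show "c > 0" "c \<le> 1 / 8"
      using \<epsilon> g by (auto simp: c_def)
    have "16 * c \<le> \<epsilon> * g ^ 3"
      by (simp add: c_def)
    then show "16 * c / g ^ 3 \<le> \<epsilon>"
      using g(1) by (simp add: pos_divide_le_eq)
  qed
  \<comment> \<open>With this choice \<open>4 * \<theta> = c / 2\<close>, which leaves the other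
    half of \<open>c\<close> for the terms that tend to 0 with \<delta>.\<close>
  define \<theta> where "\<theta> = c / 8"
  have \<theta>: "\<theta> > 0"
    using c by (simp add: \<theta>_def)
  let ?q = "\<lambda>n. 18 * \<delta> n + 4 * \<theta> + \<delta> n / \<theta>"
  have "?q \<longlonglongrightarrow> 18 * 0 + 4 * \<theta> + 0 / \<theta>"
    using \<theta> by (intro tendsto_intros assms(2)) auto
  then have "?q \<longlonglongrightarrow> c / 2"
    by (simp add: \<theta>_def)
  then have ev1: "\<forall>\<^sub>F n in sequentially. ?q n < c"
    by (rule order_tendstoD(2)) (use c(1) in simp)
  \<comment> \<open>The growth of \<open>lam\<close> provides \<open>g * M >= 8\<close>, so that the
    exploration has enough steps.\<close>
  have ev2: "\<forall>\<^sub>F n in sequentially. nat \<lceil>8 / g\<rceil> \<le> lam n"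
    using assms(1) unfolding filterlim_at_top by blast
  show "\<forall>\<^sub>F n in sequentially. \<forall>d \<pi>.
    feasible_sequence n d \<and> well_behaved lam n d \<and> sorting_permutation n d \<pi> \<and>
    real (R_seq n d \<pi>) \<le> \<delta> n * real (M_seq n d) \<longrightarrow>
    measure_pmf.prob (random_reduced_graph n d)
      {H. \<exists>C\<in>graph_components H. real (size (edges C)) \<ge> \<gamma> * real (M_seq n d)} < \<epsilon>"
    using ev1 ev2 eventually_ge_at_top[of 1]
  proof eventually_elim
    case (elim n)
    show ?case
    proof (intro allI impI)
      fix d \<pi>
      assume *: "feasible_sequence n d \<and> well_behaved lam n d \<and> sorting_permutation n d \<pi> \<and>
        real (R_seq n d \<pi>) \<le> \<delta> n * real (M_seq n d)"
      let ?M = "real (M_seq n d)" and ?R = "real (R_seq n d \<pi>)"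
      have feas: "realizations n d \<noteq> {}"
        using * by (simp add: feasible_sequence_def)
      interpret sorted_sequence n d \<pi>
        using * elim(3) by unfold_locales (auto simp: feasible_sequence_def)
      have "8 / g \<le> real (lam n)"
        using elim(2) by linarith
      also have "\<dots> \<le> ?M"
        using * by (simp add: well_behaved_def)
      finally have M: "g * ?M \<ge> 8"
        using g(1) by (simp add: pos_divide_le_eq mult.commute)
      have R: "?R \<le> \<delta> n * ?M"
        using * by blast
      have "18 * ?R + 4 * \<theta> * ?M + ?R / \<theta> \<le> ?q n * ?M"
      proof -
        have "?R / \<theta> \<le> \<delta> n * ?M / \<theta>"
          using R \<theta> by (intro divide_right_mono) auto
        then show ?thesis
          using R by (simp add: algebra_simps)
      qed
      moreover have "?q n \<le> 1 / 8"
        using elim(1) c(2) by linarith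
      ultimately have "measure_pmf.prob (random_reduced_graph n d) {H. large_component (g * ?M) H} \<le>
          16 * ?q n / g ^ 3"
        by (rule prob_large_component[OF feas \<theta> g(1,2) M])
      also have "\<dots> < 16 * c / g ^ 3"
        using elim(1) g(1) by (intro divide_strict_right_mono mult_strict_left_mono) auto
      also have "\<dots> \<le> \<epsilon>"
        by (rule c(3))
      finally have "measure_pmf.prob (random_reduced_graph n d) {H. large_component (g * ?M) H} < \<epsilon>" .
      moreover have "measure_pmf.prob (random_reduced_graph n d)
          {H. \<exists>C\<in>graph_components H. real (size (edges C)) \<ge> \<gamma> * ?M} \<le>
          measure_pmf.prob (random_reduced_graph n d) {H. large_component (g * ?M) H}"
      proof (rule measure_pmf.finite_measure_mono)
        have "g * ?M \<le> \<gamma> * ?M"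
          using g(3) by (intro mult_right_mono) auto
        then show "{H. \<exists>C\<in>graph_components H. real (size (edges C)) \<ge> \<gamma> * ?M} \<subseteq>
            {H. large_component (g * ?M) H}"
          by (auto simp: large_component_def intro: order_trans)
      qed simp
      ultimately show "measure_pmf.prob (random_reduced_graph n d)
          {H. \<exists>C\<in>graph_components H. real (size (edges C)) \<ge> \<gamma> * ?M} < \<epsilon>"
        by linarith
    qed
  qed
qed

end
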